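(* Every element of $\mathcal{R}$ is [A]-semisimple.
   Context: All topological groups are Hausdorff; t.d.l.c. means totally disconnected locally compact. The normal core of a subgroup $L$ of $K$ is $\bigcap_{k\in K}kLk^{-1}$. A t.d.l.c. group $G$ is regionally expansive if some compactly generated open subgroup $O\leq G$ has a compact open subgroup $U$ whose normal core in $O$ is trivial. A locally compact group $G$ is monolithic if the intersection of all its non-trivial closed normal subgroups is non-trivial; this intersection is then the monolith. A t.d.l.c. group $G$ is robustly monolithic if it is monolithic and its monolith is non-discrete, regionally expansive and topologically simple. $\mathcal{R}$ denotes the class of robustly monolithic groups. A t.d.l.c. group $G$ is [A]-semisimple if the only element of $G$ with open centralizer is the identity and the only abelian subgroup of $G$ with open normalizer is the trivial group. *)

theory Defs
  imports "HOL-Analysis.Analysis" "HOL-Algebra.Generated_Groups" "HOL-Algebra.Group_Action"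
begin

text \<open>
  A topological group is a group \<open>G\<close> of HOL-Algebra with an abstract topology \<open>T\<close> on its carrier.
  A subgroup \<open>H\<close> is regarded as a topological group through \<open>G\<lparr>carrier := H\<rparr>\<close> and
  \<open>subtopology T H\<close>. The Hausdorff axiom is part of the notion.
\<close>

locale topological_group = group G for G (structure) +
  fixes T :: "'a topology"
  assumes topspace_eq: "topspace T = carrier G"
    and Hausdorff: "Hausdorff_space T"
    and continuous_mult: "continuous_map (prod_topology T T) T (\<lambda>(x, y). x \<otimes> y)"
    and continuous_inv: "continuous_map T T (\<lambda>x. inv x)"

definition totally_disconnected_space :: "'a topology \<Rightarrow> bool" where
  "totally_disconnected_space S \<longleftrightarrow> (\<forall>x \<in> topspace S. connected_component_of_set S x = {x})"

locale tdlc_group = topological_group +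
  assumes locally_compact: "locally_compact_space T"
    and totally_disconnected: "totally_disconnected_space T"

definition normal_core :: "('a, 'b) monoid_scheme \<Rightarrow> 'a set \<Rightarrow> 'a set" where
  "normal_core K L = (\<Inter>k \<in> carrier K. k <#\<^bsub>K\<^esub> L #>\<^bsub>K\<^esub> inv\<^bsub>K\<^esub> k)"

definition compactly_generated :: "('a, 'b) monoid_scheme \<Rightarrow> 'a topology \<Rightarrow> bool" where
  "compactly_generated G T \<longleftrightarrow> (\<exists>C. compactin T C \<and> generate G C = carrier G)"

text \<open>
  The predicates below, like \<open>compactly_generated\<close>, are meant for (t.d.)l.c. groups but do not
  repeat that requirement; in particular, applying them to the monolith of a t.d.l.c. group does
  not hide an assumption that the monolith is again t.d.l.c.
\<close>

definition regionally_expansive :: "('a, 'b) monoid_scheme \<Rightarrow> 'a topology \<Rightarrow> bool" where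
  "regionally_expansive G T \<longleftrightarrow>
     (\<exists>H. subgroup H G \<and> openin T H \<and>
          compactly_generated (G\<lparr>carrier := H\<rparr>) (subtopology T H) \<and>
          (\<exists>U. subgroup U (G\<lparr>carrier := H\<rparr>) \<and>
               compactin (subtopology T H) U \<and> openin (subtopology T H) U \<and>
               normal_core (G\<lparr>carrier := H\<rparr>) U = {\<one>\<^bsub>G\<^esub>}))"

text \<open>
  Intersecting with the carrier only matters for the trivial group, where the family is empty
  and its plain intersection would be the whole type.
\<close>

definition monolith :: "('a, 'b) monoid_scheme \<Rightarrow> 'a topology \<Rightarrow> 'a set" where
  "monolith G T = carrier G \<inter> \<Inter>{N. N \<lhd> G \<and> closedin T N \<and> N \<noteq> {\<one>\<^bsub>G\<^esub>}}"

definition monolithic :: "('a, 'b) monoid_scheme \<Rightarrow> 'a topology \<Rightarrow> bool" where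
  "monolithic G T \<longleftrightarrow> monolith G T \<noteq> {\<one>\<^bsub>G\<^esub>}"

definition topologically_simple :: "('a, 'b) monoid_scheme \<Rightarrow> 'a topology \<Rightarrow> bool" where
  "topologically_simple G T \<longleftrightarrow>
     carrier G \<noteq> {\<one>\<^bsub>G\<^esub>} \<and>
     (\<forall>N. N \<lhd> G \<and> closedin T N \<longrightarrow> N = {\<one>\<^bsub>G\<^esub>} \<or> N = carrier G)"

definition robustly_monolithic :: "('a, 'b) monoid_scheme \<Rightarrow> 'a topology \<Rightarrow> bool" where
  "robustly_monolithic G T \<longleftrightarrow>
     tdlc_group G T \<and> monolithic G T \<and>
     (let M = monolith G T; G\<^sub>M = G\<lparr>carrier := M\<rparr>; T\<^sub>M = subtopology T M in
        T\<^sub>M \<noteq> discrete_topology M \<and>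
        regionally_expansive G\<^sub>M T\<^sub>M \<and>
        topologically_simple G\<^sub>M T\<^sub>M)"

definition centralizer :: "('a, 'b) monoid_scheme \<Rightarrow> 'a \<Rightarrow> 'a set" where
  "centralizer G x = {g \<in> carrier G. g \<otimes>\<^bsub>G\<^esub> x = x \<otimes>\<^bsub>G\<^esub> g}"

definition A_semisimple :: "('a, 'b) monoid_scheme \<Rightarrow> 'a topology \<Rightarrow> bool" where
  "A_semisimple G T \<longleftrightarrow>
     {x \<in> carrier G. openin T (centralizer G x)} = {\<one>\<^bsub>G\<^esub>} \<and>
     {A. subgroup A G \<and> comm_group (G\<lparr>carrier := A\<rparr>) \<and> openin T (normalizer G A)} = {{\<one>\<^bsub>G\<^esub>}}"

end

theory Submission
  imports Defs
begin

text \<open>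
  Let \<open>M\<close> be the monolith of \<open>G\<close>. The work lies in showing that a topologically simple, regionally
  expansive, non-discrete group \<open>M\<close> has trivial quasi-centre and no non-trivial abelian locally
  normal subgroup (a subgroup is locally normal if it is normalized by a neighbourhood of \<open>\<one>\<close>);
  passing from \<open>M\<close> to \<open>G\<close> is then short.

  Fix an open subgroup \<open>H\<close> of \<open>M\<close> that is generated by a compact set and a compact open subgroup
  \<open>U\<close> of \<open>H\<close> with trivial core. Whenever \<open>Q\<close> is dense in \<open>M\<close>, the group \<open>H\<close> is contained in the
  group generated by \<open>U\<close> and a finite subset of \<open>Q\<close>. The quasi-centralizer \<open>QC(A)\<close> consists of the
  elements that centralize a neighbourhood of \<open>\<one>\<close> in \<open>A\<close>. The basic contradiction is this: let \<open>F\<close>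
  be a finite \<open>U\<close>-invariant family of non-discrete subgroups such that the intersection \<open>QC(F)\<close> of
  the groups \<open>QC(A)\<close>, \<open>A \<in> F\<close>, is dense. Then \<open>H\<close> lies in the group generated by \<open>U\<close> and finitely
  many elements of \<open>QC(F)\<close>; these centralize all sufficiently small elements of \<open>\<Union>F\<close>, so a small
  \<open>U\<close>-invariant part of \<open>\<Union>F\<close> is invariant under \<open>H\<close> and contained in \<open>U\<close>, hence trivial
  (\<open>dense_common_quasi_centralizer\<close>). For \<open>F = {M}\<close> this shows that the quasi-centre, a normal
  subgroup, is not dense and thus trivial.

  Suppose now that there are non-trivial abelian locally normal subgroups; as the quasi-centre is
  trivial, they are non-discrete. It suffices to show that \<open>QC(F)\<close> is dense for every finite set
  \<open>F\<close> of them. Three facts are used.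

    \<^item> \<open>QC(F)\<close> has non-trivial elements in every neighbourhood of \<open>\<one>\<close>. Indeed, if a non-trivial
      intersection \<open>J\<close> of members of \<open>F\<close> is minimal, then each \<open>A \<in> F\<close> contains \<open>J\<close>, or meets it
      trivially and therefore commutes with it near \<open>\<one>\<close>.
    \<^item> Every \<open>A \<in> F\<close> normalizes \<open>QC(F)\<close>: conjugation by \<open>d \<in> A\<close> moves a small \<open>b \<in> B\<close>, \<open>B \<in> F\<close>, only by
      the commutator with \<open>d\<close>, which is a small element of \<open>A\<close>, and so is centralized whenever
      \<open>b\<close> is.
    \<^item> All abelian locally normal subgroups together generate a non-trivial normal, hence dense,
      subgroup. So \<open>H\<close> lies in the group generated by \<open>U\<close> and a finite set \<open>S\<close> of products of their
      elements, and it normalizes \<open>QC(F)\<close> for all large enough \<open>U\<close>-invariant \<open>F\<close>.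

  For such \<open>F\<close>, the group \<open>QC(F) \<inter> U\<close> is non-trivial, and it would be invariant under \<open>H\<close> if all its
  \<open>S\<close>-conjugates stayed in \<open>U\<close>. Hence \<open>QC(F)\<close> meets the compact set of those elements of \<open>U\<close> that some
  element of \<open>S\<close> or its inverse conjugates out of \<open>U\<close>, and this set does not depend on \<open>F\<close>. Since \<open>QC(F)\<close>
  decreases as \<open>F\<close> grows, compactness yields a non-trivial element in the intersection of the
  closures of all \<open>QC(F)\<close>. This intersection is a closed normal subgroup, so it is \<open>M\<close>, and every
  \<open>QC(F)\<close> is dense (\<open>no_abelian_locally_normal\<close>).

  For \<open>G\<close> itself, the normal subgroup \<open>QC(M)\<close> of \<open>G\<close> meets \<open>M\<close> in the trivial quasi-centre of \<open>M\<close>, so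
  it commutes with \<open>M\<close>. Were it non-trivial, the closed normal centralizer of \<open>M\<close> would contain \<open>M\<close>,
  making \<open>M\<close> abelian, against the triviality of its quasi-centre. So \<open>QC(M)\<close> is trivial, and it
  contains every element with open centralizer, as well as every abelian locally normal subgroup
  of \<open>G\<close>, because such a subgroup meets \<open>M\<close> trivially.
\<close>

section \<open>Conjugation\<close>

context group
begin

definition conj_by :: "'a \<Rightarrow> 'a \<Rightarrow> 'a" where
  "conj_by g x = g \<otimes> x \<otimes> inv g"

lemma conj_by_closed [simp, intro]:
  "\<lbrakk>g \<in> carrier G; x \<in> carrier G\<rbrakk> \<Longrightarrow> conj_by g x \<in> carrier G"
  by (simp add: conj_by_def)

lemma conj_by_one [simp]: "g \<in> carrier G \<Longrightarrow> conj_by g \<one> = \<one>"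
  by (simp add: conj_by_def)

lemma one_conj_by [simp]: "x \<in> carrier G \<Longrightarrow> conj_by \<one> x = x"
  by (simp add: conj_by_def)

lemma conj_by_mult:
  assumes "g \<in> carrier G" "x \<in> carrier G" "y \<in> carrier G"
  shows "conj_by g (x \<otimes> y) = conj_by g x \<otimes> conj_by g y"
proof -
  have "inv g \<otimes> (g \<otimes> (y \<otimes> inv g)) = y \<otimes> inv g"
    using assms by (simp add: m_assoc[symmetric])
  then show ?thesis
    using assms by (simp add: conj_by_def m_assoc)
qed

lemma conj_by_inv:
  "\<lbrakk>g \<in> carrier G; x \<in> carrier G\<rbrakk> \<Longrightarrow> conj_by g (inv x) = inv (conj_by g x)"
  by (simp add: conj_by_def inv_mult_group m_assoc)

lemma mult_conj_by:
  "\<lbrakk>g \<in> carrier G; h \<in> carrier G; x \<in> carrier G\<rbrakk>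
    \<Longrightarrow> conj_by (g \<otimes> h) x = conj_by g (conj_by h x)"
  by (simp add: conj_by_def inv_mult_group m_assoc)

lemma conj_by_cancel [simp]:
  assumes "g \<in> carrier G" "x \<in> carrier G"
  shows "conj_by (inv g) (conj_by g x) = x" "conj_by g (conj_by (inv g) x) = x"
  using assms by (simp_all flip: mult_conj_by)

lemma conj_by_fixed_iff:
  assumes "g \<in> carrier G" "x \<in> carrier G"
  shows "conj_by g x = x \<longleftrightarrow> g \<otimes> x = x \<otimes> g"
  using assms by (simp add: conj_by_def inv_solve_right')

lemma conj_by_commute_iff:
  assumes "g \<in> carrier G" "x \<in> carrier G" "y \<in> carrier G"
  shows "conj_by g x \<otimes> conj_by g y = conj_by g y \<otimes> conj_by g x \<longleftrightarrow> x \<otimes> y = y \<otimes> x"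
proof -
  have "inj_on (conj_by g) (carrier G)"
    by (rule inj_on_inverseI[of _ "conj_by (inv g)"]) (simp add: assms)
  then show ?thesis
    using assms by (simp add: inj_on_eq_iff flip: conj_by_mult)
qed

lemma conj_by_image_cancel [simp]:
  assumes "g \<in> carrier G" "A \<subseteq> carrier G"
  shows "conj_by (inv g) ` conj_by g ` A = A" "conj_by g ` conj_by (inv g) ` A = A"
  using assms by (simp_all add: image_image subset_iff)

lemma subgroup_conj_by_image:
  assumes "subgroup A G" "g \<in> carrier G"
  shows "subgroup (conj_by g ` A) G"
proof (rule subgroupI)
  show "conj_by g ` A \<subseteq> carrier G"
    using assms subgroup.mem_carrier by fastforce
  show "conj_by g ` A \<noteq> {}"
    using assms(1) subgroup.one_closed by fastforce
  show "inv a \<in> conj_by g ` A" if "a \<in> conj_by g ` A" for a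
    using that assms subgroup.m_inv_closed subgroup.mem_carrier
    by (fastforce simp flip: conj_by_inv)
  show "a \<otimes> b \<in> conj_by g ` A" if "a \<in> conj_by g ` A" "b \<in> conj_by g ` A" for a b
  proof -
    from that obtain x y where "x \<in> A" "y \<in> A" "a = conj_by g x" "b = conj_by g y"
      by blast
    moreover from this have "a \<otimes> b = conj_by g (x \<otimes> y)"
      using assms by (simp add: conj_by_mult subgroup.mem_carrier)
    ultimately show ?thesis
      using assms(1) by (simp add: subgroup.m_closed)
  qed
qed

lemma conj_by_image_iff:
  assumes "g \<in> carrier G" "A \<subseteq> carrier G" "x \<in> carrier G"
  shows "x \<in> conj_by g ` A \<longleftrightarrow> conj_by (inv g) x \<in> A"
proof
  assume "conj_by (inv g) x \<in> A"
  then show "x \<in> conj_by g ` A"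
    using assms by (intro image_eqI[of _ _ "conj_by (inv g) x"]) simp_all
next
  assume "x \<in> conj_by g ` A"
  then obtain a where "a \<in> A" "x = conj_by g a"
    by blast
  then show "conj_by (inv g) x \<in> A"
    using assms by (simp add: subsetD)
qed

lemma coset_conj_by: "g <# A #> inv g = conj_by g ` A"
  by (auto simp: l_coset_def r_coset_def conj_by_def)

text \<open>
  Invariance is demanded for the inverses of the generators as well, since \<open>conj_by s\<close> might
  map \<open>X\<close> properly into itself.
\<close>
lemma generate_conj_invariant:
  assumes S: "S \<subseteq> carrier G" and X: "X \<subseteq> carrier G"
    and inv: "\<And>s x. \<lbrakk>s \<in> S; x \<in> X\<rbrakk> \<Longrightarrow> conj_by s x \<in> X \<and> conj_by (inv s) x \<in> X"
    and g: "g \<in> generate G S" and x: "x \<in> X"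
  shows "conj_by g x \<in> X"
  using g x
proof (induction arbitrary: x rule: generate.induct)
  case one
  then show ?case using X by auto
next
  case (eng h1 h2)
  then show ?case
    using generate_in_carrier[OF S] subsetD[OF X] by (simp add: mult_conj_by)
next
  case (incl h)
  then show ?case using inv by blast
next
  case (inv h)
  then show ?case using assms(3) by blast
qed

lemma conj_by_conj_by:
  assumes "g \<in> carrier G" "h \<in> carrier G" "x \<in> carrier G"
  shows "conj_by g (conj_by h x) = conj_by (conj_by g h) (conj_by g x)"
proof -
  have "conj_by g h \<otimes> g = g \<otimes> h"
    using assms by (simp add: conj_by_def m_assoc)
  then show ?thesis
    using assms by (simp flip: mult_conj_by)
qed

lemma commute_inv:
  assumes "x \<in> carrier G" "a \<in> carrier G" "x \<otimes> a = a \<otimes> x"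
  shows "inv x \<otimes> a = a \<otimes> inv x"
  using assms by (metis inv_closed inv_solve_left inv_solve_right m_assoc m_closed)

lemma commute_mult:
  assumes "x \<in> carrier G" "a \<in> carrier G" "b \<in> carrier G" "x \<otimes> a = a \<otimes> x" "x \<otimes> b = b \<otimes> x"
  shows "x \<otimes> (a \<otimes> b) = (a \<otimes> b) \<otimes> x"
  using assms by (metis m_assoc)

text \<open>
  The commutator of \<open>a\<close> and \<open>b\<close> lies in \<open>A \<inter> B\<close>. Only the two conjugates that occur in it have to
  be controlled, so that \<open>A\<close> and \<open>B\<close> may be locally normal rather than normal.
\<close>
lemma commute_if_Int_trivial:
  assumes A: "subgroup A G" and B: "subgroup B G" and "A \<inter> B = {\<one>}"
    and a: "a \<in> A" and b: "b \<in> B" and "conj_by a b \<in> B" "conj_by b a \<in> A"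
  shows "a \<otimes> b = b \<otimes> a"
proof -
  have G: "a \<in> carrier G" "b \<in> carrier G"
    using A B a b subgroup.mem_carrier by fast+
  have "conj_by a b \<otimes> inv b \<in> B"
    using B b assms(6) by (simp add: subgroup.m_closed subgroup.m_inv_closed)
  moreover have "conj_by a b \<otimes> inv b = a \<otimes> inv (conj_by b a)"
    using G by (simp add: conj_by_def inv_mult_group m_assoc)
  moreover have "a \<otimes> inv (conj_by b a) \<in> A"
    using A a assms(7) by (simp add: subgroup.m_closed subgroup.m_inv_closed)
  ultimately have "conj_by a b \<otimes> inv b = \<one>"
    using assms(3) by auto
  then show ?thesis
    using G by (simp add: inv_solve_right' flip: conj_by_fixed_iff)
qed

end

section \<open>Topology of topological groups\<close>

lemma compactin_finite_subcover_image:
  assumes "compactin X K" "\<And>i. i \<in> I \<Longrightarrow> openin X (f i)" "\<And>k. k \<in> K \<Longrightarrow> \<exists>i\<in>I. k \<in> f i"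
  obtains J where "finite J" "J \<subseteq> I" "\<And>k. k \<in> K \<Longrightarrow> \<exists>i\<in>J. k \<in> f i"
proof -
  have "Ball (f ` I) (openin X) \<and> K \<subseteq> \<Union>(f ` I)"
    using assms(2,3) by blast
  then obtain \<F> where \<F>: "finite \<F>" "\<F> \<subseteq> f ` I" "K \<subseteq> \<Union>\<F>"
    using assms(1)[unfolded compactin_def, THEN conjunct2, rule_format, of "f ` I"] by auto
  obtain J where "J \<subseteq> I" "finite J" "\<F> = f ` J"
    using finite_subset_image[OF \<F>(1,2)] by blast
  then show thesis
    using that[of J] \<F>(3) by blast
qed

context topological_group
begin

lemma continuous_map_mult [continuous_intros]:
  assumes "continuous_map X T f" "continuous_map X T g"
  shows "continuous_map X T (\<lambda>x. f x \<otimes> g x)"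
  using continuous_map_compose[OF continuous_map_pairedI[OF assms] continuous_mult]
  by (simp add: o_def)

lemma continuous_map_inv [continuous_intros]:
  assumes "continuous_map X T f"
  shows "continuous_map X T (\<lambda>x. inv (f x))"
  using continuous_map_compose[OF assms continuous_inv] by (simp add: o_def)

lemma continuous_map_const_group [continuous_intros]:
  "g \<in> carrier G \<Longrightarrow> continuous_map X T (\<lambda>x. g)"
  by (simp add: topspace_eq)

lemma openin_carrierD: "\<lbrakk>openin T V; x \<in> V\<rbrakk> \<Longrightarrow> x \<in> carrier G"
  using openin_subset topspace_eq by fastforce

definition nbhd_one :: "'a set \<Rightarrow> bool" where
  "nbhd_one V \<longleftrightarrow> openin T V \<and> \<one> \<in> V"

lemma nbhd_one_Int: "\<lbrakk>nbhd_one V; nbhd_one W\<rbrakk> \<Longrightarrow> nbhd_one (V \<inter> W)"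
  by (auto simp: nbhd_one_def)

lemma nbhd_one_carrier [simp]: "nbhd_one (carrier G)"
  by (metis nbhd_one_def one_closed openin_topspace topspace_eq)

lemma nbhd_one_finite_subset:
  assumes "finite I" "\<And>i. i \<in> I \<Longrightarrow> nbhd_one (V i)"
  shows "\<exists>W. nbhd_one W \<and> (\<forall>i\<in>I. W \<subseteq> V i)"
  using assms
proof (induction I)
  case empty
  then show ?case using nbhd_one_carrier by blast
next
  case (insert i I)
  then obtain W where "nbhd_one W" "\<forall>i\<in>I. W \<subseteq> V i"
    by auto
  with insert show ?case
    by (intro exI[of _ "W \<inter> V i"]) (auto intro: nbhd_one_Int)
qed

lemma nbhd_one_vimage:
  assumes "continuous_map T T f" "f \<one> = \<one>" "nbhd_one W"
  shows "nbhd_one {x \<in> carrier G. f x \<in> W}"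
  using openin_continuous_map_preimage[OF assms(1)] assms(2,3)
  by (simp add: nbhd_one_def topspace_eq)

lemma continuous_conj_by:
  "g \<in> carrier G \<Longrightarrow> continuous_map T T (conj_by g)"
  unfolding conj_by_def by (intro continuous_intros)

lemma nbhd_one_conj_by:
  assumes "g \<in> carrier G" "nbhd_one W"
  shows "nbhd_one {x \<in> carrier G. conj_by g x \<in> W}"
  using assms by (intro nbhd_one_vimage continuous_conj_by) auto

lemma nbhd_one_symmetric:
  assumes "nbhd_one W"
  obtains V where "nbhd_one V" "V \<subseteq> W" "\<And>v. v \<in> V \<Longrightarrow> inv v \<in> V"
proof
  let ?V = "W \<inter> {x \<in> carrier G. inv x \<in> W}"
  show "nbhd_one ?V"
    using assms by (intro nbhd_one_Int nbhd_one_vimage continuous_inv) auto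
  show "inv v \<in> ?V" if "v \<in> ?V" for v
    using that by auto
qed auto

text \<open>
  The preimage of \<open>W\<close> under \<open>(k, v) \<mapsto> conj_by k v\<close> is an open set containing \<open>K \<times> {\<one>}\<close>, so by
  compactness it contains a tube around \<open>K \<times> {\<one>}\<close>.
\<close>
lemma nbhd_one_conj_by_compact:
  assumes "compactin T K" "nbhd_one W"
  obtains V where "nbhd_one V" "\<And>k v. \<lbrakk>k \<in> K; v \<in> V\<rbrakk> \<Longrightarrow> conj_by k v \<in> W"
proof -
  have K: "K \<subseteq> carrier G"
    using assms(1) compactin_subset_topspace topspace_eq by blast
  let ?P = "{p \<in> topspace (prod_topology T T). conj_by (fst p) (snd p) \<in> W}"
  have "continuous_map (prod_topology T T) T (\<lambda>p. conj_by (fst p) (snd p))"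
    unfolding conj_by_def by (intro continuous_intros continuous_map_fst continuous_map_snd)
  then have openP: "openin (prod_topology T T) ?P"
    using assms(2) by (intro openin_continuous_map_preimage) (auto simp: nbhd_one_def)
  have KP: "K \<times> {\<one>} \<subseteq> ?P"
    using K assms(2) by (auto simp: topspace_eq nbhd_one_def)
  have "compactin T {\<one>}"
    by (simp add: topspace_eq)
  then obtain K' V where "openin T V" "K \<subseteq> K'" "{\<one>} \<subseteq> V" "K' \<times> V \<subseteq> ?P"
    using openP KP by (rule Wallace_theorem_prod_topology[OF assms(1)])
  moreover from this have "conj_by k v \<in> W" if "k \<in> K" "v \<in> V" for k v
  proof -
    have "(k, v) \<in> ?P"
      using that \<open>K \<subseteq> K'\<close> \<open>K' \<times> V \<subseteq> ?P\<close> by blast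
    then show ?thesis by simp
  qed
  ultimately show thesis
    by (intro that[of V]) (auto simp: nbhd_one_def)
qed

lemma openin_right_translate:
  assumes "openin T V" "g \<in> carrier G"
  shows "openin T ((\<lambda>x. x \<otimes> g) ` V)"
proof -
  have "(\<lambda>x. x \<otimes> g) ` V = {x \<in> topspace T. x \<otimes> inv g \<in> V}"
  proof (intro equalityI subsetI)
    fix x assume "x \<in> {x \<in> topspace T. x \<otimes> inv g \<in> V}"
    then show "x \<in> (\<lambda>x. x \<otimes> g) ` V"
      using assms(2) by (intro image_eqI[of _ _ "x \<otimes> inv g"]) (auto simp: topspace_eq m_assoc)
  next
    fix x assume "x \<in> (\<lambda>x. x \<otimes> g) ` V"
    then show "x \<in> {x \<in> topspace T. x \<otimes> inv g \<in> V}"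
      using assms openin_carrierD[OF assms(1)] by (auto simp: topspace_eq m_assoc)
  qed
  moreover have "continuous_map T T (\<lambda>x. x \<otimes> inv g)"
    using assms(2) by (intro continuous_intros) auto
  ultimately show ?thesis
    using assms(1) openin_continuous_map_preimage by fastforce
qed

lemma openin_left_translate:
  assumes "openin T V" "g \<in> carrier G"
  shows "openin T ((\<lambda>x. g \<otimes> x) ` V)"
proof -
  have "(\<lambda>x. g \<otimes> x) ` V = {x \<in> topspace T. inv g \<otimes> x \<in> V}"
  proof (intro equalityI subsetI)
    fix x assume "x \<in> {x \<in> topspace T. inv g \<otimes> x \<in> V}"
    then show "x \<in> (\<lambda>x. g \<otimes> x) ` V"
      using assms(2) by (intro image_eqI[of _ _ "inv g \<otimes> x"]) (auto simp: topspace_eq m_assoc[symmetric])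
  next
    fix x assume "x \<in> (\<lambda>x. g \<otimes> x) ` V"
    then show "x \<in> {x \<in> topspace T. inv g \<otimes> x \<in> V}"
      using assms openin_carrierD[OF assms(1)] by (auto simp: topspace_eq m_assoc[symmetric])
  qed
  moreover have "continuous_map T T (\<lambda>x. inv g \<otimes> x)"
    using assms(2) by (intro continuous_intros) auto
  ultimately show ?thesis
    using assms(1) openin_continuous_map_preimage by fastforce
qed

abbreviation cl :: "'a set \<Rightarrow> 'a set" where
  "cl K \<equiv> T closure_of K"

lemma closure_of_subgroup:
  assumes "subgroup K G"
  shows "subgroup (cl K) G"
proof (rule subgroupI)
  have K: "K \<subseteq> carrier G"
    using assms subgroup.subset by blast
  show "cl K \<subseteq> carrier G"
    by (metis closure_of_subset_topspace topspace_eq)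
  have "K \<subseteq> cl K"
    using K by (simp add: closure_of_subset topspace_eq)
  then have one_cl: "\<one> \<in> cl K"
    using subgroup.one_closed[OF assms] by blast
  show "cl K \<noteq> {}"
    using one_cl by blast
  have "(\<lambda>x. inv x) ` (cl K) \<subseteq> cl ((\<lambda>x. inv x) ` K)"
    by (rule continuous_map_image_closure_subset[OF continuous_inv])
  also have "\<dots> \<subseteq> cl K"
    using assms by (intro closure_of_mono) (auto intro: subgroup.m_inv_closed)
  finally show "inv a \<in> cl K" if "a \<in> cl K" for a
    using that by blast
  have "(\<lambda>(x, y). x \<otimes> y) ` (cl K \<times> cl K)
      \<subseteq> cl ((\<lambda>(x, y). x \<otimes> y) ` (K \<times> K))"
    using continuous_map_image_closure_subset[OF continuous_mult, of "K \<times> K"]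
    by (simp add: closure_of_Times)
  also have "\<dots> \<subseteq> cl K"
    using assms by (intro closure_of_mono) (auto intro: subgroup.m_closed)
  finally show "a \<otimes> b \<in> cl K"
    if "a \<in> cl K" "b \<in> cl K" for a b
    using that by blast
qed

lemma conj_by_closure_of:
  assumes "g \<in> carrier G" "x \<in> cl K" "conj_by g ` K \<subseteq> L"
  shows "conj_by g x \<in> cl L"
proof -
  have "conj_by g ` cl K \<subseteq> cl (conj_by g ` K)"
    by (rule continuous_map_image_closure_subset[OF continuous_conj_by[OF assms(1)]])
  also have "\<dots> \<subseteq> cl L"
    by (rule closure_of_mono[OF assms(3)])
  finally show ?thesis
    using assms(2) by blast
qed

lemma closure_of_normal:
  assumes "K \<lhd> G"
  shows "cl K \<lhd> G"
proof -
  have "conj_by g x \<in> cl K" if "g \<in> carrier G" "x \<in> cl K" for g x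
    using that assms by (intro conj_by_closure_of[of g x K]) (auto simp: normal_inv_iff conj_by_def)
  then show ?thesis
    using assms closure_of_subgroup by (simp add: normal_inv_iff conj_by_def)
qed

lemma topological_group_subgroup:
  assumes "subgroup K G"
  shows "topological_group (G\<lparr>carrier := K\<rparr>) (subtopology T K)"
proof -
  have K: "K \<subseteq> carrier G"
    using assms subgroup.subset by blast
  interpret K: group "G\<lparr>carrier := K\<rparr>"
    using assms by (rule subgroup_imp_group)
  have prod: "prod_topology (subtopology T K) (subtopology T K) = subtopology (prod_topology T T) (K \<times> K)"
    by (simp add: subtopology_Times)
  show ?thesis
  proof
    show "topspace (subtopology T K) = carrier (G\<lparr>carrier := K\<rparr>)"
      using K by (auto simp: topspace_eq)
    show "Hausdorff_space (subtopology T K)"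
      using Hausdorff Hausdorff_space_subtopology by blast
    show "continuous_map (prod_topology (subtopology T K) (subtopology T K)) (subtopology T K)
        (\<lambda>(x, y). x \<otimes>\<^bsub>G\<lparr>carrier := K\<rparr>\<^esub> y)"
      unfolding prod continuous_map_in_subtopology
      using assms K by (auto intro: continuous_map_from_subtopology continuous_mult subgroup.m_closed)
    have "continuous_map (subtopology T K) (subtopology T K) (\<lambda>x. inv x)"
      unfolding continuous_map_in_subtopology
      using assms K by (auto intro: continuous_map_from_subtopology continuous_inv subgroup.m_inv_closed)
    then show "continuous_map (subtopology T K) (subtopology T K) (\<lambda>x. inv\<^bsub>G\<lparr>carrier := K\<rparr>\<^esub> x)"
      by (rule continuous_map_eq) (use assms K in \<open>auto simp: m_inv_consistent\<close>)
  qed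
qed

end

section \<open>Quasi-centralizers\<close>

context topological_group
begin

text \<open>
  For \<open>A = carrier G\<close> this is the quasi-centre, the set of elements with open centralizer.
\<close>
definition quasi_centralizer :: "'a set \<Rightarrow> 'a set" where
  "quasi_centralizer A = {x \<in> carrier G. \<exists>V. nbhd_one V \<and> (\<forall>a\<in>A \<inter> V. x \<otimes> a = a \<otimes> x)}"

lemma quasi_centralizer_carrier: "quasi_centralizer A \<subseteq> carrier G"
  by (auto simp: quasi_centralizer_def)

lemma quasi_centralizer_mono: "A \<subseteq> B \<Longrightarrow> quasi_centralizer B \<subseteq> quasi_centralizer A"
  unfolding quasi_centralizer_def by blast

lemma quasi_centralizerI:
  "\<lbrakk>x \<in> carrier G; nbhd_one V; \<And>a. \<lbrakk>a \<in> A; a \<in> V\<rbrakk> \<Longrightarrow> x \<otimes> a = a \<otimes> x\<rbrakk>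
    \<Longrightarrow> x \<in> quasi_centralizer A"
  unfolding quasi_centralizer_def by blast

lemma quasi_centralizerE:
  assumes "x \<in> quasi_centralizer A"
  obtains V where "x \<in> carrier G" "nbhd_one V" "\<forall>a\<in>A \<inter> V. x \<otimes> a = a \<otimes> x"
  using assms unfolding quasi_centralizer_def by blast

lemma subgroup_quasi_centralizer:
  assumes A: "A \<subseteq> carrier G"
  shows "subgroup (quasi_centralizer A) G"
proof (rule subgroupI)
  show "quasi_centralizer A \<subseteq> carrier G"
    by (rule quasi_centralizer_carrier)
  have "\<one> \<in> quasi_centralizer A"
    using A by (intro quasi_centralizerI[of _ "carrier G"]) auto
  then show "quasi_centralizer A \<noteq> {}"
    by blast
  show "inv x \<in> quasi_centralizer A" if x: "x \<in> quasi_centralizer A" for x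
  proof -
    from x obtain V where V: "x \<in> carrier G" "nbhd_one V" "\<forall>a\<in>A \<inter> V. x \<otimes> a = a \<otimes> x"
      by (rule quasi_centralizerE)
    then show ?thesis
      using A by (intro quasi_centralizerI[of _ V] commute_inv) auto
  qed
  show "x \<otimes> y \<in> quasi_centralizer A"
    if x: "x \<in> quasi_centralizer A" and y: "y \<in> quasi_centralizer A" for x y
  proof -
    from x obtain V where V: "x \<in> carrier G" "nbhd_one V" "\<forall>a\<in>A \<inter> V. x \<otimes> a = a \<otimes> x"
      by (rule quasi_centralizerE)
    from y obtain W where W: "y \<in> carrier G" "nbhd_one W" "\<forall>a\<in>A \<inter> W. y \<otimes> a = a \<otimes> y"
      by (rule quasi_centralizerE)
    show ?thesis
    proof (rule quasi_centralizerI[of _ "V \<inter> W"])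
      show "x \<otimes> y \<otimes> a = a \<otimes> (x \<otimes> y)" if "a \<in> A" "a \<in> V \<inter> W" for a
        using commute_mult[of a x y] that V W A by auto
    qed (use V W in \<open>auto intro: nbhd_one_Int\<close>)
  qed
qed

lemma conj_by_quasi_centralizer:
  assumes g: "g \<in> carrier G" and A: "A \<subseteq> carrier G" and x: "x \<in> quasi_centralizer A"
  shows "conj_by g x \<in> quasi_centralizer (conj_by g ` A)"
proof -
  from x obtain V where V: "x \<in> carrier G" "nbhd_one V" "\<forall>a\<in>A \<inter> V. x \<otimes> a = a \<otimes> x"
    by (rule quasi_centralizerE)
  show ?thesis
  proof (rule quasi_centralizerI)
    show "nbhd_one {y \<in> carrier G. conj_by (inv g) y \<in> V}"
      using g V by (intro nbhd_one_conj_by) auto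
    show "conj_by g x \<otimes> b = b \<otimes> conj_by g x"
      if "b \<in> conj_by g ` A" "b \<in> {y \<in> carrier G. conj_by (inv g) y \<in> V}" for b
    proof -
      from that(1) obtain a where a: "a \<in> A" "b = conj_by g a"
        by blast
      then have "a \<in> carrier G" "a \<in> V"
        using A that(2) g by auto
      with a V g show ?thesis
        by (simp add: conj_by_commute_iff)
    qed
  qed (use g V in auto)
qed

lemma normal_quasi_centralizer:
  assumes "A \<lhd> G"
  shows "quasi_centralizer A \<lhd> G"
proof -
  have A: "A \<subseteq> carrier G" "\<And>g a. \<lbrakk>g \<in> carrier G; a \<in> A\<rbrakk> \<Longrightarrow> conj_by g a \<in> A"
    using assms by (auto simp: normal_inv_iff conj_by_def subgroup.mem_carrier)
  have "conj_by g x \<in> quasi_centralizer A" if "g \<in> carrier G" "x \<in> quasi_centralizer A" for g x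
  proof -
    have "A \<subseteq> conj_by g ` A"
      using A that(1) by (auto simp: conj_by_image_iff subset_iff)
    then show ?thesis
      using conj_by_quasi_centralizer[OF that(1) A(1) that(2)] quasi_centralizer_mono by blast
  qed
  then show ?thesis
    using subgroup_quasi_centralizer[OF A(1)] by (simp add: normal_inv_iff conj_by_def)
qed

end

section \<open>Abelian locally normal subgroups\<close>

context topological_group
begin

definition locally_normal :: "'a set \<Rightarrow> bool" where
  "locally_normal A \<longleftrightarrow>
     subgroup A G \<and> (\<exists>V. nbhd_one V \<and> (\<forall>v\<in>V. \<forall>a\<in>A. conj_by v a \<in> A))"

lemma locally_normalE:
  assumes "locally_normal A"
  obtains V where "subgroup A G" "nbhd_one V" "\<forall>v\<in>V. \<forall>a\<in>A. conj_by v a \<in> A"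
  using assms unfolding locally_normal_def by blast

lemma locally_normal_Int:
  assumes "locally_normal A" "locally_normal B"
  shows "locally_normal (A \<inter> B)"
proof -
  from assms(1) obtain V where "subgroup A G" "nbhd_one V" "\<forall>v\<in>V. \<forall>a\<in>A. conj_by v a \<in> A"
    by (rule locally_normalE)
  moreover from assms(2) obtain W where "subgroup B G" "nbhd_one W" "\<forall>v\<in>W. \<forall>a\<in>B. conj_by v a \<in> B"
    by (rule locally_normalE)
  ultimately show ?thesis
    unfolding locally_normal_def
    by (intro conjI exI[of _ "V \<inter> W"]) (auto intro: nbhd_one_Int subgroups_Inter_pair)
qed

lemma locally_normal_conj_by:
  assumes g: "g \<in> carrier G" and "locally_normal A"
  shows "locally_normal (conj_by g ` A)"
proof -
  from assms(2) obtain V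
    where V: "subgroup A G" "nbhd_one V" "\<forall>v\<in>V. \<forall>a\<in>A. conj_by v a \<in> A"
    by (rule locally_normalE)
  have A: "\<And>a. a \<in> A \<Longrightarrow> a \<in> carrier G"
    using V(1) subgroup.mem_carrier by fast
  have "conj_by v (conj_by g a) \<in> conj_by g ` A"
    if "v \<in> {y \<in> carrier G. conj_by (inv g) y \<in> V}" "a \<in> A" for v a
  proof (rule image_eqI)
    have "conj_by g (conj_by (conj_by (inv g) v) a)
        = conj_by (conj_by g (conj_by (inv g) v)) (conj_by g a)"
      using that A g by (intro conj_by_conj_by) auto
    then show "conj_by v (conj_by g a) = conj_by g (conj_by (conj_by (inv g) v) a)"
      using that g by simp
    show "conj_by (conj_by (inv g) v) a \<in> A"
      using that V(3) by blast
  qed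
  moreover have "nbhd_one {y \<in> carrier G. conj_by (inv g) y \<in> V}"
    using g V by (intro nbhd_one_conj_by) auto
  ultimately show ?thesis
    using subgroup_conj_by_image[OF V(1) g] unfolding locally_normal_def by blast
qed

text \<open>
  For \<open>x \<in> A\<close>, the commutator of \<open>v\<close> and \<open>x\<close> is in \<open>A\<close> when \<open>v\<close> is close to \<open>\<one>\<close>, and it tends to \<open>\<one>\<close>
  with \<open>v\<close>. If \<open>A\<close> is discrete, it must therefore vanish for small \<open>v\<close>.
\<close>
lemma locally_normal_discrete:
  assumes "locally_normal A" and W: "nbhd_one W" "A \<inter> W \<subseteq> {\<one>}"
  shows "A \<subseteq> quasi_centralizer (carrier G)"
proof
  fix x assume x: "x \<in> A"
  from assms(1) obtain V
    where V: "subgroup A G" "nbhd_one V" "\<forall>v\<in>V. \<forall>a\<in>A. conj_by v a \<in> A"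
    by (rule locally_normalE)
  have xG: "x \<in> carrier G"
    using V(1) x subgroup.mem_carrier by fast
  let ?W = "{v \<in> carrier G. conj_by v x \<otimes> inv x \<in> W}"
  show "x \<in> quasi_centralizer (carrier G)"
  proof (rule quasi_centralizerI[of _ "V \<inter> ?W"])
    have "continuous_map T T (\<lambda>v. conj_by v x \<otimes> inv x)"
      unfolding conj_by_def using xG by (intro continuous_intros) auto
    then have "nbhd_one ?W"
      using W(1) xG by (intro nbhd_one_vimage) auto
    then show "nbhd_one (V \<inter> ?W)"
      using V(2) by (rule nbhd_one_Int[rotated])
    show "x \<otimes> v = v \<otimes> x" if "v \<in> carrier G" "v \<in> V \<inter> ?W" for v
    proof -
      have "conj_by v x \<otimes> inv x \<in> A"
        using that V(1,3) x by (simp add: subgroup.m_closed subgroup.m_inv_closed)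
      then have "conj_by v x \<otimes> inv x = \<one>"
        using that W(2) by blast
      then have "conj_by v x = x"
        using that(1) xG by (simp add: inv_solve_right')
      then show ?thesis
        using that(1) xG by (simp add: conj_by_fixed_iff)
    qed
  qed (fact xG)
qed

definition abelian_locally_normal :: "'a set set" where
  "abelian_locally_normal =
     {A. locally_normal A \<and> A \<noteq> {\<one>} \<and> (\<forall>a\<in>A. \<forall>b\<in>A. a \<otimes> b = b \<otimes> a)}"

lemma abelian_locally_normalD:
  assumes "A \<in> abelian_locally_normal"
  shows "locally_normal A" "A \<noteq> {\<one>}" "subgroup A G" "A \<subseteq> carrier G" "\<one> \<in> A"
    "\<And>a b. \<lbrakk>a \<in> A; b \<in> A\<rbrakk> \<Longrightarrow> a \<otimes> b = b \<otimes> a"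
    "A \<subseteq> quasi_centralizer A"
proof -
  show *: "locally_normal A" "A \<noteq> {\<one>}" "\<And>a b. \<lbrakk>a \<in> A; b \<in> A\<rbrakk> \<Longrightarrow> a \<otimes> b = b \<otimes> a"
    using assms by (auto simp: abelian_locally_normal_def)
  then show "subgroup A G"
    by (simp add: locally_normal_def)
  then show "A \<subseteq> carrier G" "\<one> \<in> A"
    by (auto intro: subgroup.one_closed subgroup.mem_carrier)
  then show "A \<subseteq> quasi_centralizer A"
    using *(3) by (auto intro!: quasi_centralizerI[OF _ nbhd_one_carrier])
qed

lemma abelian_locally_normal_conj_by:
  assumes "g \<in> carrier G" "A \<in> abelian_locally_normal"
  shows "conj_by g ` A \<in> abelian_locally_normal"
proof -
  note A = abelian_locally_normalD[OF assms(2)]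
  have "conj_by g ` A \<noteq> {\<one>}"
  proof
    assume "conj_by g ` A = {\<one>}"
    then have "conj_by (inv g) ` conj_by g ` A = {\<one>}"
      using assms(1) by simp
    then show False
      using assms(1) A(2,4) by simp
  qed
  moreover have "a \<otimes> b = b \<otimes> a" if "a \<in> conj_by g ` A" "b \<in> conj_by g ` A" for a b
    using that A(4,6) assms(1) by (auto simp: conj_by_commute_iff subset_iff)
  ultimately show ?thesis
    using locally_normal_conj_by[OF assms(1) A(1)] by (simp add: abelian_locally_normal_def)
qed

text \<open>
  The intersection with the carrier gives the right value for the empty family.
\<close>
definition common_quasi_centralizer :: "'a set set \<Rightarrow> 'a set" where
  "common_quasi_centralizer F = carrier G \<inter> (\<Inter>A\<in>F. quasi_centralizer A)"

lemma subgroup_common_quasi_centralizer: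
  assumes "\<And>A. A \<in> F \<Longrightarrow> A \<subseteq> carrier G"
  shows "subgroup (common_quasi_centralizer F) G"
proof -
  have "subgroup (\<Inter>(insert (carrier G) (quasi_centralizer ` F))) G"
    using assms subgroup_quasi_centralizer subgroup_self by (intro subgroups_Inter) auto
  then show ?thesis
    by (simp add: common_quasi_centralizer_def)
qed

lemma common_quasi_centralizer_antimono:
  "F \<subseteq> F' \<Longrightarrow> common_quasi_centralizer F' \<subseteq> common_quasi_centralizer F"
  by (auto simp: common_quasi_centralizer_def)

lemma conj_by_common_quasi_centralizer:
  assumes "g \<in> carrier G" "x \<in> common_quasi_centralizer F"
    and "\<And>A. A \<in> F \<Longrightarrow> A \<subseteq> carrier G"
    and F': "\<And>A. A \<in> F' \<Longrightarrow> A \<subseteq> carrier G \<and> conj_by (inv g) ` A \<in> F"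
  shows "conj_by g x \<in> common_quasi_centralizer F'"
proof -
  have "conj_by g x \<in> quasi_centralizer A" if "A \<in> F'" for A
  proof -
    have "x \<in> quasi_centralizer (conj_by (inv g) ` A)"
      using assms(2) F'[OF that] by (auto simp: common_quasi_centralizer_def)
    moreover have "conj_by (inv g) ` A \<subseteq> carrier G"
      using F'[OF that] assms(3) by blast
    ultimately have "conj_by g x \<in> quasi_centralizer (conj_by g ` conj_by (inv g) ` A)"
      using assms(1) by (intro conj_by_quasi_centralizer)
    then show ?thesis
      using assms(1) F'[OF that] by simp
  qed
  then show ?thesis
    using assms(1,2) by (simp add: common_quasi_centralizer_def)
qed

text \<open>
  For \<open>B \<in> F\<close> and \<open>b \<in> B\<close> write \<open>conj_by (inv d) b = b \<otimes> c\<close>. If \<open>b\<close> is close to \<open>\<one>\<close>, then the commutator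
  \<open>c\<close> is close to \<open>\<one>\<close> too, and it lies in \<open>A\<close> because \<open>b\<close> normalizes \<open>A\<close>. So \<open>x\<close>, which centralizes
  small elements of both \<open>A\<close> and \<open>B\<close>, commutes with \<open>conj_by (inv d) b\<close>; conjugating by \<open>d\<close> gives
  that \<open>conj_by d x\<close> commutes with \<open>b\<close>.
\<close>
lemma member_normalizes_common_quasi_centralizer:
  assumes F: "F \<subseteq> abelian_locally_normal" and A: "A \<in> F" and d: "d \<in> A"
    and x: "x \<in> common_quasi_centralizer F"
  shows "conj_by d x \<in> common_quasi_centralizer F"
proof -
  have AL: "A \<in> abelian_locally_normal"
    using F A by blast
  have dG: "d \<in> carrier G" and xG: "x \<in> carrier G"
    using abelian_locally_normalD(4)[OF AL] d x by (auto simp: common_quasi_centralizer_def)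
  from abelian_locally_normalD(1)[OF AL] obtain W
    where W: "subgroup A G" "nbhd_one W" "\<forall>v\<in>W. \<forall>a\<in>A. conj_by v a \<in> A"
    by (rule locally_normalE)
  have "x \<in> quasi_centralizer A"
    using x A by (simp add: common_quasi_centralizer_def)
  then obtain V where V: "x \<in> carrier G" "nbhd_one V" "\<forall>a\<in>A \<inter> V. x \<otimes> a = a \<otimes> x"
    by (rule quasi_centralizerE)
  have "conj_by d x \<in> quasi_centralizer B" if B: "B \<in> F" for B
  proof -
    have BG: "B \<subseteq> carrier G"
      using B F abelian_locally_normalD(4) by blast
    have "x \<in> quasi_centralizer B"
      using x B by (simp add: common_quasi_centralizer_def)
    then obtain V' where V': "x \<in> carrier G" "nbhd_one V'" "\<forall>a\<in>B \<inter> V'. x \<otimes> a = a \<otimes> x"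
      by (rule quasi_centralizerE)
    \<comment> \<open>the commutator by which conjugation with \<open>inv d\<close> changes \<open>b\<close>\<close>
    let ?c = "\<lambda>b. inv b \<otimes> conj_by (inv d) b"
    let ?N = "V' \<inter> ({b \<in> carrier G. inv b \<in> W} \<inter> {b \<in> carrier G. ?c b \<in> V})"
    show ?thesis
    proof (rule quasi_centralizerI[of _ ?N])
      have "continuous_map T T ?c"
        unfolding conj_by_def using dG by (intro continuous_intros) auto
      then show "nbhd_one ?N"
        using dG V(2) V'(2) W(2) by (intro nbhd_one_Int nbhd_one_vimage continuous_inv) auto
      show "conj_by d x \<otimes> b = b \<otimes> conj_by d x" if b: "b \<in> B" "b \<in> ?N" for b
      proof -
        have bG: "b \<in> carrier G"
          using b BG by blast
        have "?c b = conj_by (inv b) (inv d) \<otimes> d"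
          using bG dG by (simp add: conj_by_def m_assoc)
        moreover have "conj_by (inv b) (inv d) \<in> A"
          using b W(1,3) d subgroup.m_inv_closed by fastforce
        ultimately have "?c b \<in> A"
          using W(1) d by (simp add: subgroup.m_closed)
        then have "x \<otimes> ?c b = ?c b \<otimes> x"
          using b V(3) by blast
        moreover have "x \<otimes> b = b \<otimes> x"
          using b V'(3) by blast
        ultimately have "x \<otimes> (b \<otimes> ?c b) = (b \<otimes> ?c b) \<otimes> x"
          using bG dG xG commute_mult[of x b "?c b"] by simp
        moreover have "b \<otimes> ?c b = conj_by (inv d) b"
          using bG dG by (simp flip: m_assoc)
        ultimately have "conj_by d x \<otimes> conj_by d (conj_by (inv d) b)
            = conj_by d (conj_by (inv d) b) \<otimes> conj_by d x"
          using bG dG xG by (subst conj_by_commute_iff) auto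
        then show ?thesis
          using bG dG by simp
      qed
    qed (use dG xG in auto)
  qed
  then show ?thesis
    using dG xG by (simp add: common_quasi_centralizer_def)
qed

text \<open>
  The subgroup \<open>J\<close> is shrunk along \<open>F\<close>. If it meets the next member \<open>A\<close> non-trivially, it is replaced
  by \<open>J \<inter> A\<close>, which centralizes the abelian group \<open>A\<close>. Otherwise \<open>J\<close> and \<open>A\<close> normalize each other near
  \<open>\<one>\<close> and intersect trivially, so small elements commute.
\<close>
lemma quasi_commuting_locally_normal:
  assumes Z: "quasi_centralizer (carrier G) = {\<one>}"
    and "finite F" "F \<subseteq> abelian_locally_normal" "abelian_locally_normal \<noteq> {}"
  shows "\<exists>J\<in>abelian_locally_normal. \<exists>V. nbhd_one V \<and> J \<inter> V \<subseteq> common_quasi_centralizer F"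
  using assms(2,3)
proof (induction F)
  case empty
  obtain J where "J \<in> abelian_locally_normal"
    using assms(4) by blast
  then show ?case
    using abelian_locally_normalD(4) nbhd_one_carrier
    by (intro bexI[of _ J] exI[of _ "carrier G"]) (auto simp: common_quasi_centralizer_def)
next
  case (insert A F)
  then obtain J V where J: "J \<in> abelian_locally_normal" and V: "nbhd_one V" "J \<inter> V \<subseteq> common_quasi_centralizer F"
    by auto
  have A: "A \<in> abelian_locally_normal"
    using insert.prems by simp
  note JD = abelian_locally_normalD[OF J] and AD = abelian_locally_normalD[OF A]
  have ins: "common_quasi_centralizer (insert A F) = quasi_centralizer A \<inter> common_quasi_centralizer F"
    by (auto simp: common_quasi_centralizer_def)
  show ?case
  proof (cases "J \<inter> A = {\<one>}")
    case False
    have "J \<inter> A \<in> abelian_locally_normal"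
      using False JD AD locally_normal_Int by (simp add: abelian_locally_normal_def)
    moreover have "J \<inter> A \<inter> V \<subseteq> common_quasi_centralizer (insert A F)"
      using V(2) AD(7) ins by blast
    ultimately show ?thesis
      using V(1) by blast
  next
    case True
    from JD(1) obtain W1 where W1: "subgroup J G" "nbhd_one W1" "\<forall>v\<in>W1. \<forall>a\<in>J. conj_by v a \<in> J"
      by (rule locally_normalE)
    from AD(1) obtain W2 where W2: "subgroup A G" "nbhd_one W2" "\<forall>v\<in>W2. \<forall>a\<in>A. conj_by v a \<in> A"
      by (rule locally_normalE)
    have "x \<in> quasi_centralizer A" if x: "x \<in> J" "x \<in> W2" for x
    proof (rule quasi_centralizerI[OF _ W1(2)])
      show xG: "x \<in> carrier G"
        using x JD by blast
      show "x \<otimes> a = a \<otimes> x" if a: "a \<in> A" "a \<in> W1" for a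
        using commute_if_Int_trivial[OF JD(3) AD(3) True x(1) a(1)] a x W1(3) W2(3) by blast
    qed
    then have "J \<inter> (V \<inter> W2) \<subseteq> common_quasi_centralizer (insert A F)"
      using V(2) ins by blast
    then show ?thesis
      using J nbhd_one_Int[OF V(1) W2(2)] by blast
  qed
qed

lemma common_quasi_centralizer_nontrivial:
  assumes Z: "quasi_centralizer (carrier G) = {\<one>}"
    and F: "finite F" "F \<subseteq> abelian_locally_normal" "abelian_locally_normal \<noteq> {}"
    and W: "nbhd_one W"
  shows "\<exists>x\<in>common_quasi_centralizer F \<inter> W. x \<noteq> \<one>"
proof -
  obtain J V where J: "J \<in> abelian_locally_normal" and V: "nbhd_one V" "J \<inter> V \<subseteq> common_quasi_centralizer F"
    using quasi_commuting_locally_normal[OF Z F] by blast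
  have "\<not> J \<inter> (V \<inter> W) \<subseteq> {\<one>}"
  proof
    assume "J \<inter> (V \<inter> W) \<subseteq> {\<one>}"
    then have "J \<subseteq> {\<one>}"
      using locally_normal_discrete[OF _ nbhd_one_Int[OF V(1) W]] Z abelian_locally_normalD(1)[OF J]
      by simp
    then show False
      using abelian_locally_normalD(2,5)[OF J] by blast
  qed
  then show ?thesis
    using V(2) by blast
qed

text \<open>
  The element \<open>s\<close> is a product of elements of finitely many abelian locally normal groups, and each
  of these groups normalizes the common quasi-centralizer of any family to which it belongs. The
  statement covers all larger families \<open>F'\<close>, because later one family has to serve finitely many
  elements at once.
\<close>
lemma generated_normalizes_common_quasi_centralizer:
  assumes "s \<in> generate G (\<Union>abelian_locally_normal)"
  shows "\<exists>F. finite F \<and> F \<subseteq> abelian_locally_normal \<and>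
    (\<forall>F' x. F \<subseteq> F' \<and> F' \<subseteq> abelian_locally_normal \<and> x \<in> common_quasi_centralizer F' \<longrightarrow>
      conj_by s x \<in> common_quasi_centralizer F' \<and> conj_by (inv s) x \<in> common_quasi_centralizer F')"
    (is "\<exists>F. ?P s F")
  using assms
proof (induction rule: generate.induct)
  case one
  have "?P \<one> {}"
    by (auto simp: common_quasi_centralizer_def)
  then show ?case by blast
next
  case (incl d)
  then obtain A where A: "A \<in> abelian_locally_normal" "d \<in> A"
    by blast
  have d: "inv d \<in> A"
    using A abelian_locally_normalD(3) subgroup.m_inv_closed by metis
  have "?P d {A}"
    using A d member_normalizes_common_quasi_centralizer[of _ A] by auto
  then show ?case by blast
next
  case (inv d)
  then obtain A where A: "A \<in> abelian_locally_normal" "d \<in> A"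
    by blast
  have d: "inv d \<in> A" "d \<in> carrier G"
    using A abelian_locally_normalD(3,4)[of A] subgroup.m_inv_closed by auto
  have "?P (inv d) {A}"
    using A d member_normalizes_common_quasi_centralizer[of _ A] by auto
  then show ?case by blast
next
  case (eng g h)
  have "\<Union>abelian_locally_normal \<subseteq> carrier G"
    using abelian_locally_normalD(4) by blast
  then have gh: "g \<in> carrier G" "h \<in> carrier G"
    using eng.hyps generate_in_carrier by blast+
  from eng.IH obtain F1 F2 where F: "?P g F1" "?P h F2"
    by blast
  have "?P (g \<otimes> h) (F1 \<union> F2)"
  proof (intro conjI allI impI)
    fix F' x
    assume F': "F1 \<union> F2 \<subseteq> F' \<and> F' \<subseteq> abelian_locally_normal \<and> x \<in> common_quasi_centralizer F'"
    then have x: "x \<in> carrier G"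
      by (simp add: common_quasi_centralizer_def)
    have g: "conj_by g y \<in> common_quasi_centralizer F' \<and> conj_by (inv g) y \<in> common_quasi_centralizer F'"
      if "y \<in> common_quasi_centralizer F'" for y
      using F(1)[THEN conjunct2, THEN conjunct2, rule_format, of F' y] F' that by simp
    have h: "conj_by h y \<in> common_quasi_centralizer F' \<and> conj_by (inv h) y \<in> common_quasi_centralizer F'"
      if "y \<in> common_quasi_centralizer F'" for y
      using F(2)[THEN conjunct2, THEN conjunct2, rule_format, of F' y] F' that by simp
    have "conj_by g (conj_by h x) \<in> common_quasi_centralizer F'"
        "conj_by (inv h) (conj_by (inv g) x) \<in> common_quasi_centralizer F'"
      using F' g h by simp_all
    then show "conj_by (g \<otimes> h) x \<in> common_quasi_centralizer F'"
        "conj_by (inv (g \<otimes> h)) x \<in> common_quasi_centralizer F'"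
      using gh x by (simp_all add: inv_mult_group mult_conj_by)
  qed (use F in auto)
  then show ?case by blast
qed

lemma normal_generate_abelian_locally_normal:
  "generate G (\<Union>abelian_locally_normal) \<lhd> G"
proof (rule normal_generateI)
  show "\<Union>abelian_locally_normal \<subseteq> carrier G"
    using abelian_locally_normalD(4) by blast
  show "g \<otimes> h \<otimes> inv g \<in> \<Union>abelian_locally_normal"
    if "h \<in> \<Union>abelian_locally_normal" "g \<in> carrier G" for h g
  proof -
    from that(1) obtain A where A: "A \<in> abelian_locally_normal" "h \<in> A"
      by blast
    then have "conj_by g h \<in> conj_by g ` A"
      by blast
    then show ?thesis
      using abelian_locally_normal_conj_by[OF that(2) A(1)] unfolding conj_by_def[symmetric] by blast
  qed
qed

end

section \<open>Topologically simple regionally expansive groups\<close>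

text \<open>
  Here \<open>C\<close> is the compact generating set of the subgroup \<open>H = generate G C\<close> that witnesses regional
  expansivity, and \<open>U_core\<close> says that the core of \<open>U\<close> in \<open>H\<close> is trivial.
\<close>
locale expansive_simple_group = topological_group +
  fixes U C :: "'a set"
  assumes U_subgroup: "subgroup U G"
    and U_open: "openin T U"
    and U_compact: "compactin T U"
    and C_compact: "compactin T C"
    and U_core: "\<lbrakk>x \<in> U; \<And>h. h \<in> generate G C \<Longrightarrow> conj_by h x \<in> U\<rbrakk> \<Longrightarrow> x = \<one>"
    and nondiscrete: "\<not> openin T {\<one>}"
    and simple: "\<lbrakk>N \<lhd> G; closedin T N\<rbrakk> \<Longrightarrow> N = {\<one>} \<or> N = carrier G"
begin

lemma U_carrier: "u \<in> U \<Longrightarrow> u \<in> carrier G"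
  using U_subgroup subgroup.mem_carrier by fast

lemma nbhd_one_U: "nbhd_one U"
  using U_open U_subgroup by (simp add: nbhd_one_def subgroup.one_closed)

text \<open>
  As \<open>Q\<close> is dense, it meets each open coset \<open>U c\<close> with \<open>c \<in> C\<close>, so finitely many cosets \<open>U q\<close>, \<open>q \<in> Q\<close>,
  cover \<open>C\<close>.
\<close>
lemma dense_finite_generation:
  assumes Q: "Q \<subseteq> carrier G" and dense: "cl Q = carrier G"
  shows "\<exists>S. finite S \<and> S \<subseteq> Q \<and> generate G C \<subseteq> generate G (U \<union> S)"
proof -
  have CG: "C \<subseteq> carrier G"
    using C_compact compactin_subset_topspace topspace_eq by metis
  have cover: "\<exists>q\<in>Q. c \<in> (\<lambda>u. u \<otimes> q) ` U" if c: "c \<in> C" for c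
  proof -
    have cG: "c \<in> carrier G"
      using c CG by blast
    have "openin T ((\<lambda>u. u \<otimes> c) ` U)"
      using U_open cG by (rule openin_right_translate)
    moreover have "c \<in> (\<lambda>u. u \<otimes> c) ` U"
      using cG U_subgroup by (intro image_eqI[of _ _ \<one>]) (auto simp: subgroup.one_closed)
    moreover have "\<exists>q. q \<in> Q \<and> q \<in> W" if "c \<in> W" "openin T W" for W
      using cG dense that in_closure_of[of c T Q] by simp
    ultimately obtain q where q: "q \<in> Q" "q \<in> (\<lambda>u. u \<otimes> c) ` U"
      by metis
    then obtain u where u: "u \<in> U" "q = u \<otimes> c"
      by blast
    have "c = inv u \<otimes> q"
      using u cG U_carrier by (simp flip: m_assoc)
    then have "c \<in> (\<lambda>u. u \<otimes> q) ` U"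
      using u(1) U_subgroup by (intro image_eqI[of _ _ "inv u"]) (auto intro: subgroup.m_inv_closed)
    then show ?thesis
      using q(1) by blast
  qed
  obtain S where S: "finite S" "S \<subseteq> Q" "\<And>c. c \<in> C \<Longrightarrow> \<exists>q\<in>S. c \<in> (\<lambda>u. u \<otimes> q) ` U"
  proof -
    have "openin T ((\<lambda>u. u \<otimes> q) ` U)" if "q \<in> Q" for q
      using Q that by (intro openin_right_translate[OF U_open]) blast
    from compactin_finite_subcover_image[OF C_compact this cover] that show thesis
      by metis
  qed
  have US: "U \<union> S \<subseteq> carrier G"
    using S(2) Q U_carrier by blast
  have "C \<subseteq> generate G (U \<union> S)"
  proof
    fix c assume "c \<in> C"
    then obtain u q where "u \<in> U" "q \<in> S" "c = u \<otimes> q"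
      using S(3) by blast
    then show "c \<in> generate G (U \<union> S)"
      by (auto intro: generate.eng generate.incl)
  qed
  then have "generate G C \<subseteq> generate G (U \<union> S)"
    using generate_is_subgroup[OF US] by (rule generate_subgroup_incl)
  then show ?thesis
    using S by blast
qed

text \<open>
  All \<open>H\<close>-conjugates of \<open>X\<close> stay in \<open>U\<close>, so \<open>X\<close> lies in the core of \<open>U\<close>.
\<close>
lemma invariant_subset_trivial:
  assumes S: "S \<subseteq> carrier G" "generate G C \<subseteq> generate G (U \<union> S)"
    and X: "X \<subseteq> U"
    and XU: "\<And>u x. \<lbrakk>u \<in> U; x \<in> X\<rbrakk> \<Longrightarrow> conj_by u x \<in> X"
    and XS: "\<And>s x. \<lbrakk>s \<in> S; x \<in> X\<rbrakk> \<Longrightarrow> conj_by s x \<in> X \<and> conj_by (inv s) x \<in> X"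
  shows "X \<subseteq> {\<one>}"
proof
  fix x assume x: "x \<in> X"
  have "conj_by h x \<in> X" if h: "h \<in> generate G C" for h
  proof (rule generate_conj_invariant[of "U \<union> S"])
    show "U \<union> S \<subseteq> carrier G" "X \<subseteq> carrier G"
      using S(1) X U_carrier by blast+
    show "conj_by s y \<in> X \<and> conj_by (inv s) y \<in> X" if "s \<in> U \<union> S" "y \<in> X" for s y
      using that XU XS subgroup.m_inv_closed[OF U_subgroup] by (cases "s \<in> S") simp_all
    show "h \<in> generate G (U \<union> S)"
      using h S(2) by blast
  qed (fact x)
  then have "x = \<one>"
    using X x by (intro U_core) blast+
  then show "x \<in> {\<one>}" by simp
qed

text \<open>
  Finitely many elements of the common quasi-centralizer generate, together with \<open>U\<close>, a group
  containing \<open>H\<close>. They centralize all members of \<open>\<Union>F\<close> in a certain neighbourhood \<open>W\<close>. The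
  members of \<open>\<Union>F\<close> whose whole \<open>U\<close>-orbit stays in \<open>W\<close> then form an \<open>H\<close>-invariant subset of \<open>U\<close>, and by
  compactness of \<open>U\<close> this subset is a neighbourhood of \<open>\<one>\<close> in \<open>\<Union>F\<close>.
\<close>
lemma dense_common_quasi_centralizer:
  assumes fin: "finite F" and FG: "\<And>A. A \<in> F \<Longrightarrow> A \<subseteq> carrier G"
    and FU: "\<And>u A. \<lbrakk>u \<in> U; A \<in> F\<rbrakk> \<Longrightarrow> conj_by u ` A \<in> F"
    and dense: "cl (common_quasi_centralizer F) = carrier G"
  shows "\<exists>V. nbhd_one V \<and> \<Union>F \<inter> V \<subseteq> {\<one>}"
proof -
  have "common_quasi_centralizer F \<subseteq> carrier G"
    by (simp add: common_quasi_centralizer_def)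
  from dense_finite_generation[OF this dense] obtain S
    where S: "finite S" "S \<subseteq> common_quasi_centralizer F" "generate G C \<subseteq> generate G (U \<union> S)"
    by blast
  have SG: "S \<subseteq> carrier G"
    using S(2) by (auto simp: common_quasi_centralizer_def)
  have "\<exists>V. nbhd_one V \<and> (\<forall>a\<in>A \<inter> V. s \<otimes> a = a \<otimes> s)" if "s \<in> S" "A \<in> F" for s A
    using that S(2) by (auto simp: common_quasi_centralizer_def quasi_centralizer_def)
  then obtain V where V: "\<And>s A. \<lbrakk>s \<in> S; A \<in> F\<rbrakk> \<Longrightarrow> nbhd_one (V s A)"
      "\<And>s A a. \<lbrakk>s \<in> S; A \<in> F; a \<in> A; a \<in> V s A\<rbrakk> \<Longrightarrow> s \<otimes> a = a \<otimes> s"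
    by (metis IntI)
  obtain W0 where W0: "nbhd_one W0" "\<forall>p\<in>S \<times> F. W0 \<subseteq> V (fst p) (snd p)"
    using nbhd_one_finite_subset[of "S \<times> F" "\<lambda>p. V (fst p) (snd p)"] fin S(1) V(1) by auto
  let ?W = "W0 \<inter> U"
  let ?X = "{x \<in> \<Union>F. \<forall>u\<in>U. conj_by u x \<in> ?W}"
  have XG: "?X \<subseteq> carrier G"
    using FG by blast
  have XW: "?X \<subseteq> ?W"
  proof
    fix x assume x: "x \<in> ?X"
    then have "conj_by \<one> x \<in> ?W"
      using U_subgroup subgroup.one_closed by blast
    then show "x \<in> ?W"
      using x XG by auto
  qed
  have "?X \<subseteq> {\<one>}"
  proof (rule invariant_subset_trivial[OF SG S(3)])
    show "?X \<subseteq> U"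
      using XW by blast
    show "conj_by v x \<in> ?X" if v: "v \<in> U" and x: "x \<in> ?X" for v x
    proof -
      from x obtain A where A: "A \<in> F" "x \<in> A"
        by blast
      have "conj_by v x \<in> \<Union>F"
        using FU[OF v A(1)] A(2) by blast
      moreover have "conj_by u (conj_by v x) \<in> ?W" if u: "u \<in> U" for u
      proof -
        have "conj_by (u \<otimes> v) x \<in> ?W"
          using x subgroup.m_closed[OF U_subgroup u v] by simp
        moreover have "conj_by (u \<otimes> v) x = conj_by u (conj_by v x)"
          using u v U_carrier x XG by (intro mult_conj_by) blast+
        ultimately show ?thesis by simp
      qed
      ultimately show ?thesis by blast
    qed
    show "conj_by s x \<in> ?X \<and> conj_by (inv s) x \<in> ?X" if s: "s \<in> S" and x: "x \<in> ?X" for s x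
    proof -
      from x obtain A where A: "A \<in> F" "x \<in> A"
        by blast
      have sG: "s \<in> carrier G" and xG: "x \<in> carrier G"
        using s SG x XG by blast+
      have "x \<in> V s A"
      proof -
        have "x \<in> W0"
          using subsetD[OF XW x] by simp
        then show ?thesis
          using bspec[OF W0(2), of "(s, A)"] s A(1) by auto
      qed
      then have "s \<otimes> x = x \<otimes> s"
        using V(2) s A by blast
      then have "conj_by s x = x"
        using sG xG by (simp add: conj_by_fixed_iff)
      moreover from this have "conj_by (inv s) x = x"
        using sG xG conj_by_cancel(1)[of s x] by simp
      ultimately show ?thesis
        using x by simp
    qed
  qed
  moreover obtain V1 where V1: "nbhd_one V1" "\<And>k v. \<lbrakk>k \<in> U; v \<in> V1\<rbrakk> \<Longrightarrow> conj_by k v \<in> ?W"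
    using nbhd_one_conj_by_compact[OF U_compact nbhd_one_Int[OF W0(1) nbhd_one_U]] by blast
  ultimately have "\<Union>F \<inter> V1 \<subseteq> {\<one>}"
    by blast
  then show ?thesis
    using V1(1) by blast
qed

lemma quasi_center_trivial: "quasi_centralizer (carrier G) = {\<one>}"
proof -
  let ?Q = "quasi_centralizer (carrier G)"
  have normal: "?Q \<lhd> G"
    by (rule normal_quasi_centralizer[OF normal_self])
  have Q: "?Q \<subseteq> cl ?Q" "\<one> \<in> ?Q"
    using normal quasi_centralizer_carrier
    by (simp_all add: normal_inv_iff subgroup.one_closed topspace_eq closure_of_subset)
  have "cl ?Q = {\<one>} \<or> cl ?Q = carrier G"
    using closure_of_normal[OF normal] by (intro simple) auto
  moreover have "cl ?Q \<noteq> carrier G"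
  proof
    assume dense: "cl ?Q = carrier G"
    have "common_quasi_centralizer {carrier G} = ?Q"
      using quasi_centralizer_carrier by (auto simp: common_quasi_centralizer_def)
    moreover have "conj_by u ` carrier G = carrier G" if "u \<in> U" for u
    proof (rule Set.set_eqI)
      fix x show "x \<in> conj_by u ` carrier G \<longleftrightarrow> x \<in> carrier G"
        using U_carrier[OF that] conj_by_image_iff[of u "carrier G" x] by auto
    qed
    ultimately obtain V where V: "nbhd_one V" "carrier G \<inter> V \<subseteq> {\<one>}"
      using dense_common_quasi_centralizer[of "{carrier G}"] dense by auto
    then have "V = {\<one>}"
      using openin_carrierD unfolding nbhd_one_def by blast
    then show False
      using V(1) nondiscrete by (simp add: nbhd_one_def)
  qed
  ultimately show ?thesis
    using Q by blast
qed

text \<open>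
  The conjugate of \<open>A\<close> by \<open>u \<in> U\<close> is a locally constant function of \<open>u\<close>, and \<open>U\<close> is compact.
\<close>
lemma finite_conjugates:
  assumes "A \<in> abelian_locally_normal"
  shows "finite ((\<lambda>u. conj_by u ` A) ` U)"
proof -
  note AD = abelian_locally_normalD[OF assms]
  from AD(1) obtain W where W: "subgroup A G" "nbhd_one W" "\<forall>v\<in>W. \<forall>a\<in>A. conj_by v a \<in> A"
    by (rule locally_normalE)
  obtain V where V: "nbhd_one V" "V \<subseteq> W" "\<And>v. v \<in> V \<Longrightarrow> inv v \<in> V"
    using nbhd_one_symmetric[OF W(2)] by blast
  have VG: "v \<in> carrier G" if "v \<in> V" for v
    using V(1) that openin_carrierD[of V v] by (simp add: nbhd_one_def)
  have VA: "conj_by v ` A = A" if v: "v \<in> V" for v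
  proof
    show "conj_by v ` A \<subseteq> A"
      using v V(2) W(3) by blast
    have "conj_by (inv v) a \<in> A" if "a \<in> A" for a
      using V(2,3) v W(3) that by blast
    then show "A \<subseteq> conj_by v ` A"
      using AD(4) VG[OF v] by (auto simp: conj_by_image_iff subset_iff)
  qed
  have cover: "\<exists>r\<in>U. u \<in> (\<lambda>v. r \<otimes> v) ` V" if "u \<in> U" for u
  proof
    show "u \<in> (\<lambda>v. u \<otimes> v) ` V"
      using V(1) U_carrier[OF that] by (intro image_eqI[of _ _ \<one>]) (auto simp: nbhd_one_def)
  qed (fact that)
  have "openin T ((\<lambda>v. r \<otimes> v) ` V)" if "r \<in> U" for r
    using V(1) U_carrier[OF that] by (intro openin_left_translate) (auto simp: nbhd_one_def)
  from compactin_finite_subcover_image[OF U_compact this cover] obtain R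
    where R: "finite R" "R \<subseteq> U" "\<And>u. u \<in> U \<Longrightarrow> \<exists>r\<in>R. u \<in> (\<lambda>v. r \<otimes> v) ` V"
    by metis
  have "(\<lambda>u. conj_by u ` A) ` U \<subseteq> (\<lambda>u. conj_by u ` A) ` R"
  proof
    fix B assume "B \<in> (\<lambda>u. conj_by u ` A) ` U"
    then obtain u where u: "u \<in> U" "B = conj_by u ` A"
      by blast
    then obtain r v where r: "r \<in> R" "v \<in> V" "u = r \<otimes> v"
      using R(3) by blast
    have "conj_by u ` A = conj_by r ` conj_by v ` A"
      using r R(2) U_carrier VG AD(4) by (auto simp: image_image mult_conj_by subset_iff)
    then show "B \<in> (\<lambda>u. conj_by u ` A) ` R"
      using u(2) r(1) VA[OF r(2)] by simp
  qed
  then show ?thesis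
    by (rule finite_subset) (simp add: R(1))
qed

lemma conjugation_closed_superset:
  assumes "finite F" "F \<subseteq> abelian_locally_normal"
  obtains F' where "finite F'" "F \<subseteq> F'" "F' \<subseteq> abelian_locally_normal"
    "\<And>u A. \<lbrakk>u \<in> U; A \<in> F'\<rbrakk> \<Longrightarrow> conj_by u ` A \<in> F'"
proof
  let ?F = "\<Union>A\<in>F. (\<lambda>u. conj_by u ` A) ` U"
  show "finite ?F"
    using assms by (intro finite_UN_I finite_conjugates) auto
  show "F \<subseteq> ?F"
  proof
    fix A assume A: "A \<in> F"
    then have "A \<subseteq> carrier G"
      using assms(2) abelian_locally_normalD(4) by blast
    then have "conj_by \<one> ` A = A"
      by (simp add: subset_iff)
    then have "A \<in> (\<lambda>u. conj_by u ` A) ` U"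
      using subgroup.one_closed[OF U_subgroup] by (intro image_eqI[of _ _ \<one>]) simp_all
    then show "A \<in> ?F"
      using A by blast
  qed
  show "?F \<subseteq> abelian_locally_normal"
    using assms(2) U_carrier abelian_locally_normal_conj_by by blast
  show "conj_by u ` B \<in> ?F" if u: "u \<in> U" and B: "B \<in> ?F" for u B
  proof -
    from B obtain A v where A: "A \<in> F" "v \<in> U" "B = conj_by v ` A"
      by blast
    have "A \<subseteq> carrier G"
      using A(1) assms(2) abelian_locally_normalD(4) by blast
    then have "conj_by u ` B = conj_by (u \<otimes> v) ` A"
      using A(2,3) u U_carrier by (auto simp: image_image mult_conj_by subset_iff)
    moreover have "u \<otimes> v \<in> U"
      by (rule subgroup.m_closed[OF U_subgroup u A(2)])
    ultimately show ?thesis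
      using A(1) by blast
  qed
qed

text \<open>
  This makes a compactness argument possible: quasi-centralizers of larger and larger families
  shrink, but they cannot shrink to \<open>\<one>\<close>. The set \<open>K\<close> consists of the elements of \<open>U\<close> that are conjugated
  out of \<open>U\<close> by one of finitely many elements \<open>s\<close> or their inverses; together with \<open>U\<close> these
  elements generate a group containing \<open>H\<close>, and they normalize the quasi-centralizers of all sufficiently
  large families. A
  quasi-centralizer missing \<open>K\<close> would meet \<open>U\<close> in an \<open>H\<close>-invariant, hence trivial, set.
\<close>
lemma common_quasi_centralizers_meet_compact:
  assumes "abelian_locally_normal \<noteq> {}"
  obtains K where "compactin T K" "\<one> \<notin> K"
    "\<And>F. \<lbrakk>finite F; F \<subseteq> abelian_locally_normal\<rbrakk> \<Longrightarrow> K \<inter> common_quasi_centralizer F \<noteq> {}"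
proof -
  let ?D = "generate G (\<Union>abelian_locally_normal)"
  have DG: "?D \<subseteq> carrier G"
    using abelian_locally_normalD(4) by (intro generate_incl) blast
  have "cl ?D = {\<one>} \<or> cl ?D = carrier G"
    using closure_of_normal[OF normal_generate_abelian_locally_normal] by (intro simple) auto
  moreover have "cl ?D \<noteq> {\<one>}"
  proof
    assume "cl ?D = {\<one>}"
    then have "?D \<subseteq> {\<one>}"
      using DG closure_of_subset[of ?D T] by (simp add: topspace_eq)
    then have "A \<subseteq> {\<one>}" if "A \<in> abelian_locally_normal" for A
      using that generate.incl[of _ "\<Union>abelian_locally_normal" G] by blast
    then show False
      using assms abelian_locally_normalD(2,5) by blast
  qed
  ultimately obtain S where S: "finite S" "S \<subseteq> ?D" "generate G C \<subseteq> generate G (U \<union> S)"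
    using dense_finite_generation[OF DG] by blast
  have SG: "S \<subseteq> carrier G"
    using S(2) DG by blast
  have "\<forall>s\<in>S. \<exists>F. finite F \<and> F \<subseteq> abelian_locally_normal \<and>
    (\<forall>F' x. F \<subseteq> F' \<and> F' \<subseteq> abelian_locally_normal \<and> x \<in> common_quasi_centralizer F' \<longrightarrow>
      conj_by s x \<in> common_quasi_centralizer F' \<and> conj_by (inv s) x \<in> common_quasi_centralizer F')"
    using S(2) generated_normalizes_common_quasi_centralizer by blast
  then obtain f where f: "\<forall>s\<in>S. finite (f s) \<and> f s \<subseteq> abelian_locally_normal \<and>
    (\<forall>F' x. f s \<subseteq> F' \<and> F' \<subseteq> abelian_locally_normal \<and> x \<in> common_quasi_centralizer F' \<longrightarrow>
      conj_by s x \<in> common_quasi_centralizer F' \<and> conj_by (inv s) x \<in> common_quasi_centralizer F')"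
    by (rule bchoice[THEN exE])
  \<comment> \<open>\<open>?O\<close> collects the elements that all of \<open>S\<close> and its inverses conjugate into \<open>U\<close>\<close>
  let ?P = "\<lambda>s. {x \<in> carrier G. conj_by s x \<in> U} \<inter> {x \<in> carrier G. conj_by (inv s) x \<in> U}"
  let ?O = "(\<Inter>s\<in>S. ?P s) \<inter> topspace T"
  let ?K = "U \<inter> (topspace T - ?O)"
  show thesis
  proof
    have "openin T ?O"
    proof (rule openin_INT[OF S(1)])
      fix s assume "s \<in> S"
      then have "nbhd_one (?P s)"
        using SG nbhd_one_U by (intro nbhd_one_Int nbhd_one_conj_by) auto
      then show "openin T (?P s)"
        by (simp add: nbhd_one_def)
    qed
    then show "compactin T ?K"
      using U_compact by (intro compact_Int_closedin) auto
    have "\<one> \<in> ?O"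
      using SG U_subgroup by (auto simp: topspace_eq subgroup.one_closed subset_iff)
    then show "\<one> \<notin> ?K"
      by blast
    show "?K \<inter> common_quasi_centralizer F \<noteq> {}"
      if F: "finite F" "F \<subseteq> abelian_locally_normal" for F
    proof
      assume disj: "?K \<inter> common_quasi_centralizer F = {}"
      have "finite (F \<union> (\<Union>s\<in>S. f s))" "F \<union> (\<Union>s\<in>S. f s) \<subseteq> abelian_locally_normal"
        using F S(1) f by auto
      then obtain F' where F': "finite F'" "F \<union> (\<Union>s\<in>S. f s) \<subseteq> F'" "F' \<subseteq> abelian_locally_normal"
        "\<And>u A. \<lbrakk>u \<in> U; A \<in> F'\<rbrakk> \<Longrightarrow> conj_by u ` A \<in> F'"
        using conjugation_closed_superset by metis
      have F'G: "A \<subseteq> carrier G" if "A \<in> F'" for A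
        using that F'(3) abelian_locally_normalD(4) by blast
      let ?X = "common_quasi_centralizer F' \<inter> U"
      have XO: "x \<in> ?O" if "x \<in> ?X" for x
        using that disj common_quasi_centralizer_antimono[of F F'] F'(2) U_carrier
        by (auto simp: topspace_eq)
      have "?X \<subseteq> {\<one>}"
      proof (rule invariant_subset_trivial[OF SG S(3)])
        show "conj_by u x \<in> ?X" if u: "u \<in> U" and x: "x \<in> ?X" for u x
        proof -
          have "inv u \<in> U"
            by (rule subgroup.m_inv_closed[OF U_subgroup u])
          then have "conj_by u x \<in> common_quasi_centralizer F'"
            using x U_carrier[OF u] F'(4) F'G by (intro conj_by_common_quasi_centralizer[of u x F' F']) auto
          moreover have "conj_by u x \<in> U"
            using u x U_subgroup by (simp add: conj_by_def subgroup.m_closed subgroup.m_inv_closed)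
          ultimately show ?thesis by blast
        qed
        show "conj_by s x \<in> ?X \<and> conj_by (inv s) x \<in> ?X" if s: "s \<in> S" and x: "x \<in> ?X" for s x
        proof -
          have "f s \<subseteq> F'"
            using s F'(2) by blast
          then have "conj_by s x \<in> common_quasi_centralizer F' \<and> conj_by (inv s) x \<in> common_quasi_centralizer F'"
            using f[rule_format, OF s, THEN conjunct2, THEN conjunct2, rule_format, of F' x] x F'(3) by simp
          moreover have "conj_by s x \<in> U \<and> conj_by (inv s) x \<in> U"
            using XO[OF x] s by blast
          ultimately show ?thesis by blast
        qed
      qed blast
      then show False
        using common_quasi_centralizer_nontrivial[OF quasi_center_trivial F'(1,3) assms nbhd_one_U] by blast
    qed
  qed
qed

text \<open>
  The intersection \<open>N\<close> of the closures of the common quasi-centralizers of all finite families is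
  normal, since conjugation permutes the families, and it is non-trivial by compactness of \<open>K\<close>. So
  \<open>N\<close> is the whole group and all common quasi-centralizers are dense, which
  \<open>dense_common_quasi_centralizer\<close> only permits for discrete, hence quasi-central, members.
\<close>
lemma no_abelian_locally_normal: "abelian_locally_normal = {}"
proof (rule ccontr)
  assume nonempty: "abelian_locally_normal \<noteq> {}"
  let ?L = "{F. finite F \<and> F \<subseteq> abelian_locally_normal}"
  define N where "N = (\<Inter>F\<in>?L. cl (common_quasi_centralizer F))"
  have LG: "A \<subseteq> carrier G" if "F \<in> ?L" "A \<in> F" for F A
    using that abelian_locally_normalD(4) by blast
  obtain K where K: "compactin T K" "\<one> \<notin> K"
    "\<And>F. \<lbrakk>finite F; F \<subseteq> abelian_locally_normal\<rbrakk> \<Longrightarrow> K \<inter> common_quasi_centralizer F \<noteq> {}"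
    using common_quasi_centralizers_meet_compact[OF nonempty] by blast
  have "K \<inter> N \<noteq> {}"
  proof -
    have fip: "K \<inter> \<Inter>\<F> \<noteq> {}"
      if \<F>: "finite \<F>" "\<F> \<subseteq> (\<lambda>F. cl (common_quasi_centralizer F)) ` ?L" for \<F>
    proof -
      obtain \<G> where \<G>: "\<G> \<subseteq> ?L" "finite \<G>" "\<F> = (\<lambda>F. cl (common_quasi_centralizer F)) ` \<G>"
        using finite_subset_image[OF \<F>] by blast
      have "finite (\<Union>\<G>)" "\<Union>\<G> \<subseteq> abelian_locally_normal"
        using \<G>(1,2) by auto
      then have "K \<inter> common_quasi_centralizer (\<Union>\<G>) \<noteq> {}"
        by (rule K(3))
      then obtain x where x: "x \<in> K" "x \<in> common_quasi_centralizer (\<Union>\<G>)"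
        by blast
      have "x \<in> cl (common_quasi_centralizer F)" if "F \<in> \<G>" for F
      proof -
        have "x \<in> common_quasi_centralizer F"
          using that x(2) common_quasi_centralizer_antimono[of F "\<Union>\<G>"] by blast
        moreover have "common_quasi_centralizer F \<subseteq> cl (common_quasi_centralizer F)"
          by (rule closure_of_subset) (simp add: common_quasi_centralizer_def topspace_eq)
        ultimately show ?thesis by blast
      qed
      then show ?thesis
        using x(1) \<G>(3) by blast
    qed
    show ?thesis
      using K(1)[unfolded compactin_fip, THEN conjunct2, THEN spec,
          of "(\<lambda>F. cl (common_quasi_centralizer F)) ` ?L"] fip by (simp add: N_def)
  qed
  then have "N \<noteq> {\<one>}"
    using K(2) by blast
  moreover have "N \<lhd> G"
  proof -
    have "subgroup N G"
      unfolding N_def using LG subgroup_common_quasi_centralizer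
      by (intro subgroups_Inter) (auto intro!: closure_of_subgroup)
    moreover have "conj_by g x \<in> cl (common_quasi_centralizer F)"
      if g: "g \<in> carrier G" and x: "x \<in> N" and F: "F \<in> ?L" for g x F
    proof (rule conj_by_closure_of[OF g])
      let ?F = "(\<lambda>A. conj_by (inv g) ` A) ` F"
      have F': "?F \<in> ?L"
        using F g abelian_locally_normal_conj_by by auto
      then show "x \<in> cl (common_quasi_centralizer ?F)"
        using x unfolding N_def by blast
      show "conj_by g ` common_quasi_centralizer ?F \<subseteq> common_quasi_centralizer F"
        using conj_by_common_quasi_centralizer[OF g, of _ ?F F] LG[OF F] LG[OF F'] by blast
    qed
    ultimately show ?thesis
      by (simp add: normal_inv_iff conj_by_def N_def)
  qed
  moreover have "closedin T N"
    unfolding N_def by (intro closedin_INT) auto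
  ultimately have N: "N = carrier G"
    using simple by blast
  obtain A where A: "A \<in> abelian_locally_normal"
    using nonempty by blast
  then obtain F where F: "finite F" "{A} \<subseteq> F" "F \<subseteq> abelian_locally_normal"
    "\<And>u A. \<lbrakk>u \<in> U; A \<in> F\<rbrakk> \<Longrightarrow> conj_by u ` A \<in> F"
    using conjugation_closed_superset[of "{A}"] by auto
  have "carrier G \<subseteq> cl (common_quasi_centralizer F)"
    using N F(1,3) unfolding N_def by blast
  then have "cl (common_quasi_centralizer F) = carrier G"
    using closure_of_subset_topspace[of T] topspace_eq by auto
  moreover have "\<And>B. B \<in> F \<Longrightarrow> B \<subseteq> carrier G"
    using LG F(1,3) by simp
  ultimately obtain V where V: "nbhd_one V" "\<Union>F \<inter> V \<subseteq> {\<one>}"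
    using dense_common_quasi_centralizer[OF F(1) _ F(4)] by metis
  then have "A \<inter> V \<subseteq> {\<one>}"
    using F(2) by blast
  then have "A \<subseteq> {\<one>}"
    using locally_normal_discrete[OF abelian_locally_normalD(1)[OF A] V(1)] quasi_center_trivial by simp
  then show False
    using abelian_locally_normalD(2,5)[OF A] by blast
qed

end

context topological_group
begin

lemma discrete_if_openin_one:
  assumes "openin T {\<one>}"
  shows "T = discrete_topology (carrier G)"
proof -
  have "openin T {x}" if "x \<in> carrier G" for x
    using openin_left_translate[OF assms that] that by simp
  then show ?thesis
    using discrete_topology_unique[of "carrier G" T] topspace_eq by auto
qed

lemma expansive_simple_groupI:
  assumes "regionally_expansive G T" "topologically_simple G T" "T \<noteq> discrete_topology (carrier G)"
  obtains U C where "expansive_simple_group G T U C"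
proof -
  obtain H U C where H: "subgroup H G" "openin T H"
    and C: "compactin (subtopology T H) C" "generate (G\<lparr>carrier := H\<rparr>) C = H"
    and U: "subgroup U (G\<lparr>carrier := H\<rparr>)" "compactin (subtopology T H) U" "openin (subtopology T H) U"
    and core: "normal_core (G\<lparr>carrier := H\<rparr>) U = {\<one>}"
    using assms(1) unfolding regionally_expansive_def compactly_generated_def by auto
  have HG: "h \<in> carrier G" if "h \<in> H" for h
    using that H(1) subgroup.mem_carrier by fast
  have UH: "U \<subseteq> H"
    using U(1) subgroup.subset by fastforce
  have "C \<subseteq> H"
    using C(1) by (simp add: compactin_subtopology)
  then have gen: "generate G C = H"
    using C(2) H(1) generate_consistent by metis
  have "expansive_simple_group G T U C"
  proof (intro expansive_simple_group.intro expansive_simple_group_axioms.intro topological_group_axioms)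
    show "subgroup U G"
      using H(1) U(1) by (rule incl_subgroup)
    show "openin T U"
      using U(3) H(2) by (simp add: openin_open_subtopology)
    show "compactin T U" "compactin T C"
      using U(2) C(1) by (simp_all add: compactin_subtopology)
    show "x = \<one>" if x: "x \<in> U" "\<And>h. h \<in> generate G C \<Longrightarrow> conj_by h x \<in> U" for x
    proof -
      have "x \<in> k <#\<^bsub>G\<lparr>carrier := H\<rparr>\<^esub> U #>\<^bsub>G\<lparr>carrier := H\<rparr>\<^esub> inv\<^bsub>G\<lparr>carrier := H\<rparr>\<^esub> k" if k: "k \<in> H" for k
      proof -
        have "conj_by (inv k) x \<in> U"
          using x(2) k gen subgroup.m_inv_closed[OF H(1)] by simp
        then have "x \<in> conj_by k ` U"
          using conj_by_image_iff[of k U x] HG k x(1) UH by (simp add: subset_iff)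
        then show ?thesis
          using k H(1) by (auto simp: l_coset_def r_coset_def conj_by_def m_inv_consistent)
      qed
      then have "x \<in> normal_core (G\<lparr>carrier := H\<rparr>) U"
        by (simp add: normal_core_def)
      then show ?thesis
        using core by simp
    qed
    show "\<not> openin T {\<one>}"
      using assms(3) discrete_if_openin_one by blast
    show "N = {\<one>} \<or> N = carrier G" if "N \<lhd> G" "closedin T N" for N
      using that assms(2) by (simp add: topologically_simple_def)
  qed
  then show thesis by (rule that)
qed

end

section \<open>From the monolith to the ambient group\<close>

context topological_group
begin

lemma centralizer_of_normal:
  assumes M: "M \<lhd> G"
  defines "Z \<equiv> {x \<in> carrier G. \<forall>m\<in>M. x \<otimes> m = m \<otimes> x}"
  shows "Z \<lhd> G" "closedin T Z"
proof -
  have MG: "M \<subseteq> carrier G" "\<And>g m. \<lbrakk>g \<in> carrier G; m \<in> M\<rbrakk> \<Longrightarrow> conj_by g m \<in> M"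
    using M by (auto simp: normal_inv_iff conj_by_def subgroup.mem_carrier)
  have "subgroup Z G"
  proof (rule subgroupI)
    show "Z \<noteq> {}"
      using MG(1) by (auto simp: Z_def intro!: exI[of _ \<one>])
    show "inv x \<in> Z" if "x \<in> Z" for x
      using that MG(1) by (auto simp: Z_def intro!: commute_inv)
    show "x \<otimes> y \<in> Z" if "x \<in> Z" "y \<in> Z" for x y
    proof -
      have "x \<otimes> y \<otimes> m = m \<otimes> (x \<otimes> y)" if "m \<in> M" for m
        using commute_mult[of m x y] that \<open>x \<in> Z\<close> \<open>y \<in> Z\<close> MG(1) by (auto simp: Z_def)
      then show ?thesis
        using that by (simp add: Z_def)
    qed
  qed (simp add: Z_def)
  moreover have "conj_by g x \<in> Z" if g: "g \<in> carrier G" and x: "x \<in> Z" for g x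
  proof -
    have "conj_by g x \<otimes> m = m \<otimes> conj_by g x" if m: "m \<in> M" for m
    proof -
      have "conj_by (inv g) m \<in> M"
        using MG(2) g m by simp
      then have "x \<otimes> conj_by (inv g) m = conj_by (inv g) m \<otimes> x"
        using x by (simp add: Z_def)
      then have "conj_by g x \<otimes> conj_by g (conj_by (inv g) m) = conj_by g (conj_by (inv g) m) \<otimes> conj_by g x"
        using g m x MG(1) by (subst conj_by_commute_iff) (auto simp: Z_def)
      then show ?thesis
        using g m MG(1) by auto
    qed
    then show ?thesis
      using g x by (simp add: Z_def)
  qed
  ultimately show "Z \<lhd> G"
    by (simp add: normal_inv_iff conj_by_def)
  have "closedin T {x \<in> topspace T. conj_by x m \<in> {m}}" if "m \<in> M" for m
  proof (rule closedin_continuous_map_preimage)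
    show "continuous_map T T (\<lambda>x. conj_by x m)"
      unfolding conj_by_def using that MG(1) by (intro continuous_intros) auto
    show "closedin T {m}"
      using that MG(1) Hausdorff by (intro closedin_Hausdorff_singleton) (auto simp: topspace_eq)
  qed
  moreover have "M \<noteq> {}"
    using M subgroup.one_closed by (auto simp: normal_inv_iff)
  moreover have "Z = (\<Inter>m\<in>M. {x \<in> topspace T. conj_by x m \<in> {m}})"
  proof (rule Set.set_eqI)
    fix x
    show "x \<in> Z \<longleftrightarrow> x \<in> (\<Inter>m\<in>M. {x \<in> topspace T. conj_by x m \<in> {m}})"
    proof (cases "x \<in> carrier G")
      case True
      then have "conj_by x m = m \<longleftrightarrow> x \<otimes> m = m \<otimes> x" if "m \<in> M" for m
        using MG(1) that by (intro conj_by_fixed_iff) auto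
      with True show ?thesis
        by (simp add: Z_def topspace_eq)
    next
      case False
      then show ?thesis
        using \<open>M \<noteq> {}\<close> by (auto simp: Z_def topspace_eq)
    qed
  qed
  ultimately show "closedin T Z"
    by (auto intro: closedin_INT)
qed

lemma monolith_normal: "monolith G T \<lhd> G"
  and monolith_least: "\<lbrakk>N \<lhd> G; closedin T N; N \<noteq> {\<one>}\<rbrakk> \<Longrightarrow> monolith G T \<subseteq> N"
proof -
  let ?\<N> = "{N. N \<lhd> G \<and> closedin T N \<and> N \<noteq> {\<one>}}"
  have "subgroup (\<Inter>(insert (carrier G) ?\<N>)) G"
    using subgroup_self by (intro subgroups_Inter) (auto simp: normal_inv_iff)
  then show "monolith G T \<lhd> G"
    by (auto simp: normal_inv_iff monolith_def)
  show "monolith G T \<subseteq> N" if "N \<lhd> G" "closedin T N" "N \<noteq> {\<one>}" for N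
    using that by (auto simp: monolith_def)
qed

end

locale robust_monolith = topological_group +
  fixes M U C
  assumes M_normal: "M \<lhd> G"
    and M_least: "\<lbrakk>N \<lhd> G; closedin T N; N \<noteq> {\<one>}\<rbrakk> \<Longrightarrow> M \<subseteq> N"
    and expansive: "expansive_simple_group (G\<lparr>carrier := M\<rparr>) (subtopology T M) U C"
begin

sublocale M: expansive_simple_group "G\<lparr>carrier := M\<rparr>" "subtopology T M" U C
  by (rule expansive)

lemma M_subgroup: "subgroup M G"
  using M_normal by (simp add: normal_inv_iff)

lemma M_carrier: "M \<subseteq> carrier G"
  using M_subgroup subgroup.subset by blast

lemma conj_by_M: "\<lbrakk>g \<in> carrier G; m \<in> M\<rbrakk> \<Longrightarrow> conj_by g m \<in> M"
  using M_normal by (simp add: normal_inv_iff conj_by_def)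

lemma M_nontrivial: "M \<noteq> {\<one>}"
proof
  assume "M = {\<one>}"
  moreover have "openin (subtopology T M) M"
    using M_carrier openin_topspace[of "subtopology T M"] by (simp add: topspace_eq Int_absorb1)
  ultimately show False
    using M.nondiscrete by simp
qed

lemma M_conj_by: "g \<in> M \<Longrightarrow> M.conj_by g x = conj_by g x"
  unfolding M.conj_by_def conj_by_def using M_subgroup by (simp add: m_inv_consistent)

lemma M_nbhd_one: "nbhd_one V \<Longrightarrow> M.nbhd_one (V \<inter> M)"
  using M_subgroup by (auto simp: nbhd_one_def M.nbhd_one_def openin_subtopology subgroup.one_closed)

lemma M_Int_quasi_centralizer: "M \<inter> quasi_centralizer M = {\<one>}"
proof -
  have "x = \<one>" if x: "x \<in> M" "x \<in> quasi_centralizer M" for x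
  proof -
    from x(2) obtain V where V: "x \<in> carrier G" "nbhd_one V" "\<forall>a\<in>M \<inter> V. x \<otimes> a = a \<otimes> x"
      by (rule quasi_centralizerE)
    have "x \<in> M.quasi_centralizer (carrier (G\<lparr>carrier := M\<rparr>))"
      using x(1) V(3) by (intro M.quasi_centralizerI[OF _ M_nbhd_one[OF V(2)]]) auto
    then show ?thesis
      using M.quasi_center_trivial by simp
  qed
  moreover have "\<one> \<in> M \<inter> quasi_centralizer M"
    using M_subgroup subgroup_quasi_centralizer[OF M_carrier] subgroup.one_closed by fast
  ultimately show ?thesis
    by blast
qed

text \<open>
  The quasi-centralizer of \<open>M\<close> and \<open>M\<close> are normal subgroups with trivial intersection, so they
  commute. If the centralizer of \<open>M\<close> were non-trivial, it would contain \<open>M\<close>, and \<open>M\<close> would be its own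
  quasi-centre.
\<close>
lemma quasi_centralizer_M: "quasi_centralizer M = {\<one>}"
proof -
  let ?Q = "quasi_centralizer M"
  let ?Z = "{x \<in> carrier G. \<forall>m\<in>M. x \<otimes> m = m \<otimes> x}"
  have Q: "?Q \<lhd> G"
    using M_normal by (rule normal_quasi_centralizer)
  then have Q_subgroup: "subgroup ?Q G" and conj_Q: "\<And>g x. \<lbrakk>g \<in> carrier G; x \<in> ?Q\<rbrakk> \<Longrightarrow> conj_by g x \<in> ?Q"
    by (auto simp: normal_inv_iff conj_by_def)
  have QG: "?Q \<subseteq> carrier G"
    by (rule quasi_centralizer_carrier)
  have "x \<otimes> m = m \<otimes> x" if "x \<in> ?Q" "m \<in> M" for x m
    using that M_Int_quasi_centralizer QG M_carrier
    by (intro commute_if_Int_trivial[OF Q_subgroup M_subgroup] conj_by_M conj_Q) auto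
  then have "?Q \<subseteq> ?Z"
    using QG by blast
  moreover have "?Z = {\<one>}"
  proof (rule ccontr)
    assume "?Z \<noteq> {\<one>}"
    then have "M \<subseteq> ?Z"
      using centralizer_of_normal[OF M_normal] by (intro M_least)
    then have "M \<subseteq> ?Q"
      using M_carrier by (auto intro!: quasi_centralizerI[OF _ nbhd_one_carrier])
    then show False
      using M_Int_quasi_centralizer M_nontrivial by blast
  qed
  moreover have "\<one> \<in> ?Q"
    using Q_subgroup by (rule subgroup.one_closed)
  ultimately show ?thesis
    by blast
qed

text \<open>
  The intersection \<open>A \<inter> M\<close> is abelian and locally normal in \<open>M\<close>, thus trivial. As \<open>M\<close> is normalized by
  \<open>A\<close> and \<open>A\<close> by small elements of \<open>M\<close>, these small elements commute with \<open>A\<close>, and \<open>A\<close> is contained in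
  the quasi-centralizer of \<open>M\<close>.
\<close>
lemma abelian_locally_normal_trivial:
  assumes "locally_normal A" and abelian: "\<And>a b. \<lbrakk>a \<in> A; b \<in> A\<rbrakk> \<Longrightarrow> a \<otimes> b = b \<otimes> a"
  shows "A = {\<one>}"
proof -
  from assms(1) obtain V where V: "subgroup A G" "nbhd_one V" "\<forall>v\<in>V. \<forall>a\<in>A. conj_by v a \<in> A"
    by (rule locally_normalE)
  have AG: "a \<in> carrier G" if "a \<in> A" for a
    using that V(1) subgroup.mem_carrier by fast
  have "M.locally_normal (A \<inter> M)"
    unfolding M.locally_normal_def
  proof (intro conjI exI ballI)
    show "subgroup (A \<inter> M) (G\<lparr>carrier := M\<rparr>)"
      using V(1) M_subgroup by (intro subgroup_incl subgroups_Inter_pair) auto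
    show "M.nbhd_one (V \<inter> M)"
      using V(2) by (rule M_nbhd_one)
    show "M.conj_by v a \<in> A \<inter> M" if "v \<in> V \<inter> M" "a \<in> A \<inter> M" for v a
      using that V(3) M_carrier by (auto simp: M_conj_by intro: conj_by_M)
  qed
  then have AM: "A \<inter> M = {\<one>}"
    using M.no_abelian_locally_normal abelian by (auto simp: M.abelian_locally_normal_def)
  have "A \<subseteq> quasi_centralizer M"
  proof
    fix a assume a: "a \<in> A"
    show "a \<in> quasi_centralizer M"
    proof (rule quasi_centralizerI[OF AG[OF a] V(2)])
      show "a \<otimes> m = m \<otimes> a" if "m \<in> M" "m \<in> V" for m
        using that V(3) a AG[OF a] by (intro commute_if_Int_trivial[OF V(1) M_subgroup AM] conj_by_M) auto
    qed
  qed
  then show ?thesis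
    using quasi_centralizer_M subgroup.one_closed[OF V(1)] by blast
qed

lemma A_semisimple: "A_semisimple G T"
proof -
  have "{x \<in> carrier G. openin T (centralizer G x)} = {\<one>}"
  proof (intro equalityI subsetI)
    fix x assume "x \<in> {x \<in> carrier G. openin T (centralizer G x)}"
    then have "x \<in> quasi_centralizer M"
      by (intro quasi_centralizerI[of _ "centralizer G x"]) (auto simp: nbhd_one_def centralizer_def)
    then show "x \<in> {\<one>}"
      using quasi_centralizer_M by simp
  next
    fix x assume "x \<in> {\<one>}"
    moreover have "centralizer G \<one> = topspace T"
      by (auto simp: centralizer_def topspace_eq)
    ultimately show "x \<in> {x \<in> carrier G. openin T (centralizer G x)}"
      by simp
  qed
  moreover have "{A. subgroup A G \<and> comm_group (G\<lparr>carrier := A\<rparr>) \<and> openin T (normalizer G A)} = {{\<one>}}"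
    (is "?\<A> = _")
  proof (intro equalityI subsetI)
    fix A assume A: "A \<in> ?\<A>"
    then have AG: "A \<subseteq> carrier G"
      using subgroup.subset by blast
    then have normalizer: "normalizer G A = {g \<in> carrier G. conj_by g ` A = A}"
      by (simp add: normalizer_def stabilizer_def coset_conj_by)
    have "conj_by \<one> ` A = A"
      using AG by (simp add: subset_iff)
    then have "nbhd_one (normalizer G A)"
      using A by (simp add: nbhd_one_def normalizer)
    then have "locally_normal A"
      using A unfolding locally_normal_def by (intro conjI exI[of _ "normalizer G A"]) (auto simp: normalizer)
    moreover have "a \<otimes> b = b \<otimes> a" if "a \<in> A" "b \<in> A" for a b
      using A that comm_monoid.m_comm[of "G\<lparr>carrier := A\<rparr>"] by (simp add: comm_group_def)
    ultimately show "A \<in> {{\<one>}}"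
      using abelian_locally_normal_trivial by simp
  next
    fix A assume "A \<in> {{\<one>}}"
    then have A: "A = {\<one>}" by simp
    have "normalizer G A = topspace T"
      by (auto simp: A normalizer_def stabilizer_def coset_conj_by topspace_eq)
    moreover have "comm_group (G\<lparr>carrier := A\<rparr>)"
      using subgroup_imp_group[OF triv_subgroup] by (intro group.group_comm_groupI) (auto simp: A)
    ultimately show "A \<in> ?\<A>"
      using triv_subgroup A by simp
  qed
  ultimately show ?thesis
    by (simp add: A_semisimple_def)
qed

end

theorem theorem1p2p5:
  fixes G :: "('a, 'b) monoid_scheme" and T :: "'a topology"
  assumes "robustly_monolithic G T"
  shows "A_semisimple G T"
proof -
  let ?M = "monolith G T"
  have "tdlc_group G T"
    and M: "subtopology T ?M \<noteq> discrete_topology ?M"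
      "regionally_expansive (G\<lparr>carrier := ?M\<rparr>) (subtopology T ?M)"
      "topologically_simple (G\<lparr>carrier := ?M\<rparr>) (subtopology T ?M)"
    using assms by (simp_all add: robustly_monolithic_def Let_def)
  then interpret topological_group G T
    by (simp add: tdlc_group_def)
  have "topological_group (G\<lparr>carrier := ?M\<rparr>) (subtopology T ?M)"
    using monolith_normal by (intro topological_group_subgroup) (simp add: normal_inv_iff)
  then obtain U C where expansive: "expansive_simple_group (G\<lparr>carrier := ?M\<rparr>) (subtopology T ?M) U C"
    using M topological_group.expansive_simple_groupI[of "G\<lparr>carrier := ?M\<rparr>" "subtopology T ?M"]
    by auto
  interpret robust_monolith G T ?M U C
    by (intro robust_monolith.intro robust_monolith_axioms.intro topological_group_axioms
        monolith_normal monolith_least expansive)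
  show ?thesis
    by (rule A_semisimple)
qed

end
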